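(* Let $T>0$ and $f(z)=\Lambda z$ with $\Lambda\ge0$. The insurer program $$\sup_{\phi\in\mathcal C}\ \mathcal U(\phi)$$ admits a solution $\phi^*\in\mathcal C$, i.e. there exists $\phi^*\in\mathcal C$ with $\mathcal U(\phi^* )=\sup_{\phi\in\mathcal C}\mathcal U(\phi)$.
   Context: Let $(\Omega,\mathcal F,(\mathcal F_t)_{t\ge0},\mathbb Q)$ be a filtered probability space satisfying the usual conditions; $\mathbb E$ and $\mathbb V$ denote expectation and variance, and $\mathbb R^+=[0,\infty)$. Let $\Theta$ be a measure on $(\mathbb R^+,\mathcal B(\mathbb R^+))$ with finite moments up to order two: $\int_0^\infty(1+z+z^2)\,\Theta(dz)<\infty$, and $\overline\theta:=\int_0^\infty z\,\Theta(dz)$. Let $f(z)=\Lambda z$ with $\Lambda\overline\theta<\beta$, where $\beta$ is a constant. Let $(T_i,Z_i)_{i\ge1}$ be a marked point process (loss times and loss sizes), let $\nu(dt,dz)$ be the associated random counting measure, and assume it is a marked Hawkes process: the compensator of $\nu$ is $\lambda_{t^-}\Theta(dz)\,dt$, where $$\lambda_t=\lambda_0+\beta\int_0^t(\underline\lambda-\lambda_{s^-})\,ds+\int_0^{t^-}\int_{\mathbb R^+}f(z)\,\nu(ds,dz),$$ with constant intensities $\lambda_0>\underline\lambda\ge0$. Under these assumptions $\lambda$ is well defined and has finite moments up to order two. The set of reinsurance contracts is $\mathcal C=\{h:\mathbb R^+\to\mathbb R\text{ measurable}:\ 0\le h(z)\le z\ \ \Theta\text{-a.s.}\}$, viewed as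 a subset of $L^2(\Theta)$. The insurer's wealth under $\phi\in\mathcal C$ is $$R_t(\phi)=R_0+\int_0^t\int_0^\infty(\phi(z)-z)\,\nu(ds,dz)+\rho\,\overline\theta\,t-c\,t\int_0^\infty\phi(z)\,\Theta(dz),$$ where $R_0,\rho,c$ are constants, and the criterion is $\mathcal U(\phi)=\mathbb E[R_T(\phi)]-\gamma\,\mathbb V[R_T(\phi)]$ with a constant $\gamma>0$. *)

theory Defs
  imports "HOL-Probability.Probability"
begin

abbreviation Rplus :: "real measure"
  where "Rplus \<equiv> restrict_space borel {0..}"

section \<open>Filtered probability spaces\<close>

text \<open>The filtration is indexed by \<open>t \<ge> 0\<close>; its values at negative reals are irrelevant.\<close>

locale usual_filtered_prob_space = prob_space Q for Q :: "'a measure" +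
  fixes F :: "real \<Rightarrow> 'a measure"
  assumes subalg: "0 \<le> t \<Longrightarrow> subalgebra Q (F t)"
    and mono: "0 \<le> s \<Longrightarrow> s \<le> t \<Longrightarrow> sets (F s) \<subseteq> sets (F t)"
    and right_continuous: "0 \<le> t \<Longrightarrow> (\<Inter>s\<in>{t<..}. sets (F s)) = sets (F t)"
    and complete_space: "complete_measure Q"
    and null_sets_F0: "null_sets Q \<subseteq> sets (F 0)"

definition predictable_sigma :: "'a measure \<Rightarrow> (real \<Rightarrow> 'a measure) \<Rightarrow> ('a \<times> real) measure"
  where "predictable_sigma Q F = sigma (space Q \<times> {0..})
    ({A \<times> {0} | A. A \<in> sets (F 0)} \<union>
     {A \<times> {s<..t} | A s t. 0 \<le> s \<and> s \<le> t \<and> A \<in> sets (F s)})"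

section \<open>Marked point processes and compensators\<close>

text \<open>The points are numbered from \<open>0\<close>. The value \<open>\<tau> i \<omega> = \<infinity>\<close> means that the \<open>i\<close>-th loss never
  occurs; it cannot be excluded, since the intensity may tend to \<open>0\<close>. The mark \<open>Z i \<omega>\<close> is then
  irrelevant. Adaptedness says that each \<open>\<tau> i\<close> is a stopping time whose mark is known at
  time \<open>\<tau> i\<close>.\<close>

definition marked_point_process ::
    "'a measure \<Rightarrow> (real \<Rightarrow> 'a measure) \<Rightarrow> (nat \<Rightarrow> 'a \<Rightarrow> ennreal) \<Rightarrow> (nat \<Rightarrow> 'a \<Rightarrow> real) \<Rightarrow> bool"
  where "marked_point_process Q F \<tau> Z \<longleftrightarrow>
    (\<forall>i. \<tau> i \<in> borel_measurable Q) \<and> (\<forall>i. Z i \<in> measurable Q Rplus) \<and>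
    (\<forall>i. \<forall>t\<ge>0. \<forall>B\<in>sets borel. {\<omega> \<in> space Q. \<tau> i \<omega> \<le> ennreal t \<and> Z i \<omega> \<in> B} \<in> sets (F t)) \<and>
    (AE \<omega> in Q. 0 < \<tau> 0 \<omega> \<and>
       (\<forall>i. \<tau> i \<omega> \<le> \<tau> (Suc i) \<omega> \<and> (\<tau> i \<omega> < \<infinity> \<longrightarrow> \<tau> i \<omega> < \<tau> (Suc i) \<omega>)) \<and>
       (\<lambda>i. \<tau> i \<omega>) \<longlonglongrightarrow> \<infinity>)"

text \<open>The random counting measure \<open>\<Sum>i. \<delta>(\<tau> i, Z i)\<close>, the sum running over \<open>\<tau> i < \<infinity>\<close>.\<close>

definition counting_random_measure ::
    "(nat \<Rightarrow> 'a \<Rightarrow> ennreal) \<Rightarrow> (nat \<Rightarrow> 'a \<Rightarrow> real) \<Rightarrow> 'a \<Rightarrow> (real \<times> real) measure"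
  where "counting_random_measure \<tau> Z \<omega> =
    distr (count_space {i. \<tau> i \<omega> < \<infinity>}) (Rplus \<Otimes>\<^sub>M Rplus) (\<lambda>i. (enn2real (\<tau> i \<omega>), Z i \<omega>))"

text \<open>\<open>\<mu>\<close> is the compensator (dual predictable projection) of the random measure \<open>\<nu>\<close>: it is
  predictable and gives every nonnegative predictable integrand \<open>H(\<omega>, t, z)\<close> the same
  expected integral as \<open>\<nu>\<close>.\<close>

definition is_compensator ::
    "'a measure \<Rightarrow> (real \<Rightarrow> 'a measure) \<Rightarrow> ('a \<Rightarrow> (real \<times> real) measure) \<Rightarrow>
     ('a \<Rightarrow> (real \<times> real) measure) \<Rightarrow> bool"
  where "is_compensator Q F \<nu> \<mu> \<longleftrightarrow>
    (\<forall>H :: ('a \<times> real) \<times> real \<Rightarrow> ennreal. H \<in> borel_measurable (predictable_sigma Q F \<Otimes>\<^sub>M Rplus) \<longrightarrow>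
      (\<lambda>(\<omega>, t). \<integral>\<^sup>+(s, z)\<in>{0..t} \<times> {0..}. H ((\<omega>, s), z) \<partial>\<mu> \<omega>)
          \<in> borel_measurable (predictable_sigma Q F) \<and>
      (\<integral>\<^sup>+\<omega>. (\<integral>\<^sup>+(s, z). H ((\<omega>, s), z) \<partial>\<nu> \<omega>) \<partial>Q) =
      (\<integral>\<^sup>+\<omega>. (\<integral>\<^sup>+(s, z). H ((\<omega>, s), z) \<partial>\<mu> \<omega>) \<partial>Q))"

section \<open>Marked Hawkes processes\<close>

definition left_lim :: "(real \<Rightarrow> real) \<Rightarrow> real \<Rightarrow> real"
  where "left_lim x t = (if t \<le> 0 then x 0 else Lim (at_left t) x)"

text \<open>The intensity equation, for all \<open>t \<ge> 0\<close> simultaneously outside a null set. The integral up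
  to \<open>t-\<close> is taken over \<open>[0, t)\<close>. The parameters \<open>l0\<close> and \<open>l\<close> are the initial and the base
  intensity.\<close>

definition hawkes_intensity ::
    "'a measure \<Rightarrow> (real \<Rightarrow> 'a measure) \<Rightarrow> ('a \<Rightarrow> (real \<times> real) measure) \<Rightarrow> (real \<Rightarrow> real) \<Rightarrow>
     real \<Rightarrow> real \<Rightarrow> real \<Rightarrow> (real \<Rightarrow> 'a \<Rightarrow> real) \<Rightarrow> bool"
  where "hawkes_intensity Q F \<nu> f \<beta> l0 l lam \<longleftrightarrow>
    (\<forall>t\<ge>0. lam t \<in> borel_measurable (F t)) \<and>
    (AE \<omega> in Q. \<forall>t\<ge>0.
       set_integrable lborel {0..t} (left_lim (\<lambda>u. lam u \<omega>)) \<and>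
       lam t \<omega> = l0 + \<beta> * (LBINT s:{0..t}. l - left_lim (\<lambda>u. lam u \<omega>) s)
                 + (LINT (s, z):{0..<t} \<times> {0..}|\<nu> \<omega>. f z))"

text \<open>The random measure \<open>\<lambda>(t-) \<Theta>(dz) dt\<close>.\<close>

definition intensity_measure ::
    "real measure \<Rightarrow> (real \<Rightarrow> 'a \<Rightarrow> real) \<Rightarrow> 'a \<Rightarrow> (real \<times> real) measure"
  where "intensity_measure \<Theta> lam \<omega> =
    density (restrict_space lborel {0..} \<Otimes>\<^sub>M \<Theta>) (\<lambda>(t, z). ennreal (left_lim (\<lambda>u. lam u \<omega>) t))"

definition marked_hawkes_process ::
    "'a measure \<Rightarrow> (real \<Rightarrow> 'a measure) \<Rightarrow> real measure \<Rightarrow> (real \<Rightarrow> real) \<Rightarrow> real \<Rightarrow> real \<Rightarrow> real \<Rightarrow>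
     (nat \<Rightarrow> 'a \<Rightarrow> ennreal) \<Rightarrow> (nat \<Rightarrow> 'a \<Rightarrow> real) \<Rightarrow> (real \<Rightarrow> 'a \<Rightarrow> real) \<Rightarrow> bool"
  where "marked_hawkes_process Q F \<Theta> f \<beta> l0 l \<tau> Z lam \<longleftrightarrow>
    marked_point_process Q F \<tau> Z \<and>
    hawkes_intensity Q F (counting_random_measure \<tau> Z) f \<beta> l0 l lam \<and>
    is_compensator Q F (counting_random_measure \<tau> Z) (intensity_measure \<Theta> lam)"

section \<open>The insurer's problem\<close>

text \<open>Contracts are represented by functions instead of classes modulo \<open>\<Theta>\<close>-null sets. Square
  integrability follows from \<open>0 \<le> h z \<le> z\<close> and the finite second moment of \<open>\<Theta>\<close>.\<close>

definition contracts :: "real measure \<Rightarrow> (real \<Rightarrow> real) set"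
  where "contracts \<Theta> = {h. h \<in> borel_measurable \<Theta> \<and> (AE z in \<Theta>. 0 \<le> h z \<and> h z \<le> z)}"

definition mean_loss :: "real measure \<Rightarrow> real"
  where "mean_loss \<Theta> = (\<integral>z. z \<partial>\<Theta>)"

definition wealth ::
    "real measure \<Rightarrow> ('a \<Rightarrow> (real \<times> real) measure) \<Rightarrow> real \<Rightarrow> real \<Rightarrow> real \<Rightarrow>
     (real \<Rightarrow> real) \<Rightarrow> real \<Rightarrow> 'a \<Rightarrow> real"
  where "wealth \<Theta> \<nu> R0 \<rho> c \<phi> t \<omega> =
    R0 + (LINT (s, z):{0..t} \<times> {0..}|\<nu> \<omega>. \<phi> z - z) + \<rho> * mean_loss \<Theta> * t - c * t * (\<integral>z. \<phi> z \<partial>\<Theta>)"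

definition mean_variance :: "'a measure \<Rightarrow> real \<Rightarrow> ('a \<Rightarrow> real) \<Rightarrow> real"
  where "mean_variance Q \<gamma> X = prob_space.expectation Q X - \<gamma> * prob_space.variance Q X"

definition criterion ::
    "'a measure \<Rightarrow> real measure \<Rightarrow> ('a \<Rightarrow> (real \<times> real) measure) \<Rightarrow> real \<Rightarrow> real \<Rightarrow> real \<Rightarrow>
     real \<Rightarrow> real \<Rightarrow> (real \<Rightarrow> real) \<Rightarrow> real"
  where "criterion Q \<Theta> \<nu> R0 \<rho> c \<gamma> T \<phi> = mean_variance Q \<gamma> (wealth \<Theta> \<nu> R0 \<rho> c \<phi> T)"

end

theory Submission
  imports Defs
begin

text \<open>Existence is the direct method of the calculus of variations. The wealth is an affine function
  of the contract, so the mean-variance criterion \<open>J\<close> is concave on the convex set of contracts.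
  If contracts converge \<open>\<Theta>\<close>-almost everywhere, then the wealths converge almost surely, dominated
  by a constant plus the total loss \<open>L\<close> up to a time after \<open>T\<close>; hence \<open>J\<close> converges as soon as
  \<open>L\<close> is square integrable. Weak compactness of the contracts in \<open>L\<^sup>2(\<Theta>)\<close> would finish the proof.
  The lemma \<open>midpoint_concave_attains_max\<close> replaces it by an elementary argument: almost
  optimal contracts of almost minimal \<open>L\<^sup>2\<close> norm form a Cauchy sequence by the parallelogram law,
  so that a subsequence converges almost everywhere.

  What remains is probabilistic. That \<open>\<Theta>\<close>-almost everywhere statements about contracts pass to
  the observed marks (\<open>AE_marks\<close>) is the compensator formula for the indicator of a null set.
  That \<open>L\<close> is square integrable (\<open>losses_second_moment\<close>) is a Gronwall argument. The square of
  the running loss \<open>L(t)\<close> increases by \<open>2 L(t-) z + z\<^sup>2\<close> at a loss of size \<open>z\<close>, and the intensity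
  equation bounds the intensity by an affine function of \<open>L(t-)\<close>. The compensator formula
  therefore bounds \<open>E[L(t)\<^sup>2]\<close> by \<open>c\<close> times the integral of \<open>1 + E[L(s)\<^sup>2]\<close> over \<open>s \<le> t\<close>. To have finite
  quantities in Gronwall's inequality, only the increments with \<open>L(t-) \<le> K\<close> are counted, and
  \<open>K\<close> tends to infinity in the end, the bound being independent of \<open>K\<close>.\<close>

section \<open>Mean-variance of square integrable random variables\<close>

lemma integrable_of_square_dominated:
  fixes X W :: "'b \<Rightarrow> real"
  assumes "X \<in> borel_measurable M" and "integrable M (\<lambda>x. (W x)\<^sup>2)" and "AE x in M. \<bar>X x\<bar> \<le> W x"
  shows "integrable M (\<lambda>x. (X x)\<^sup>2)"
proof (rule Bochner_Integration.integrable_bound[OF assms(2)])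
  show "(\<lambda>x. (X x)\<^sup>2) \<in> borel_measurable M" using assms(1) by measurable
  show "AE x in M. norm ((X x)\<^sup>2) \<le> norm ((W x)\<^sup>2)"
    using assms(3) by eventually_elim (auto simp: abs_le_square_iff[symmetric])
qed

lemma integrable_mult_of_squares:
  fixes X Y :: "'b \<Rightarrow> real"
  assumes [measurable]: "X \<in> borel_measurable M" "Y \<in> borel_measurable M"
    and "integrable M (\<lambda>x. (X x)\<^sup>2)" "integrable M (\<lambda>x. (Y x)\<^sup>2)"
  shows "integrable M (\<lambda>x. X x * Y x)"
proof (rule Bochner_Integration.integrable_bound)
  show "integrable M (\<lambda>x. (X x)\<^sup>2 + (Y x)\<^sup>2)" using assms by simp
  have "\<bar>a * b\<bar> \<le> a\<^sup>2 + b\<^sup>2" for a b :: real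
  proof -
    have "0 \<le> (\<bar>a\<bar> - \<bar>b\<bar>)\<^sup>2" by simp
    then have "2 * (\<bar>a\<bar> * \<bar>b\<bar>) \<le> a\<^sup>2 + b\<^sup>2" by (simp add: power2_diff)
    then show ?thesis using mult_nonneg_nonneg[OF abs_ge_zero abs_ge_zero, of a b]
      unfolding abs_mult by linarith
  qed
  then show "AE x in M. norm (X x * Y x) \<le> norm ((X x)\<^sup>2 + (Y x)\<^sup>2)"
    by (intro AE_I2) simp
qed measurable

context prob_space
begin

lemma mean_variance_eq:
  assumes [measurable]: "X \<in> borel_measurable M" and "integrable M (\<lambda>x. (X x)\<^sup>2)"
  shows "mean_variance M \<gamma> X
    = expectation X - \<gamma> * (expectation (\<lambda>x. (X x)\<^sup>2) - (expectation X)\<^sup>2)"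
  unfolding mean_variance_def
  using variance_eq[of X] square_integrable_imp_integrable[of X] assms by simp

lemma mean_variance_cong_AE:
  assumes [measurable]: "X \<in> borel_measurable M" "Y \<in> borel_measurable M"
    and eq: "AE x in M. X x = Y x"
  shows "mean_variance M \<gamma> X = mean_variance M \<gamma> Y"
proof -
  have e: "expectation X = expectation Y" by (rule integral_cong_AE) (use eq in measurable)
  have "variance X = variance Y" unfolding e
    by (rule integral_cong_AE) (use eq in \<open>measurable, auto elim!: eventually_mono\<close>)
  with e show ?thesis by (simp add: mean_variance_def)
qed

lemma mean_variance_midpoint:
  assumes [measurable]: "X \<in> borel_measurable M" "Y \<in> borel_measurable M"
    and X2[simp]: "integrable M (\<lambda>x. (X x)\<^sup>2)" and Y2[simp]: "integrable M (\<lambda>x. (Y x)\<^sup>2)"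
    and "0 \<le> \<gamma>"
  shows "mean_variance M \<gamma> X + mean_variance M \<gamma> Y
    \<le> 2 * mean_variance M \<gamma> (\<lambda>x. (X x + Y x) / 2)"
proof -
  have XY[simp]: "integrable M (\<lambda>x. X x * Y x)"
    by (rule integrable_mult_of_squares) simp_all
  have X1[simp]: "integrable M X" and Y1[simp]: "integrable M Y"
    by (rule square_integrable_imp_integrable[OF _ X2], simp)
      (rule square_integrable_imp_integrable[OF _ Y2], simp)
  have mid2: "((X x + Y x) / 2)\<^sup>2 = (X x)\<^sup>2 / 4 + (Y x)\<^sup>2 / 4 + (X x * Y x) / 2" for x
    by (simp add: power2_eq_square field_simps)
  have dif2: "(X x - Y x)\<^sup>2 = (X x)\<^sup>2 + (Y x)\<^sup>2 - 2 * (X x * Y x)" for x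
    by (simp add: power2_eq_square field_simps)
  define a b p q r where "a = expectation X" and "b = expectation Y"
    and "p = expectation (\<lambda>x. (X x)\<^sup>2)" and "q = expectation (\<lambda>x. (Y x)\<^sup>2)"
    and "r = expectation (\<lambda>x. X x * Y x)"
  note defs = this
  have mX: "mean_variance M \<gamma> X = a - \<gamma> * (p - a\<^sup>2)" and mY: "mean_variance M \<gamma> Y = b - \<gamma> * (q - b\<^sup>2)"
    by (simp_all add: mean_variance_eq defs)
  have mM: "mean_variance M \<gamma> (\<lambda>x. (X x + Y x) / 2)
      = (a + b) / 2 - \<gamma> * (p / 4 + q / 4 + r / 2 - ((a + b) / 2)\<^sup>2)"
    by (subst mean_variance_eq) (simp_all add: mid2 defs)
  \<comment> \<open>The defect in concavity is \<open>\<gamma>/2\<close> times the variance of \<open>X - Y\<close>.\<close>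
  have "0 \<le> variance (\<lambda>x. X x - Y x)" by (rule variance_positive)
  also have "\<dots> = p + q - 2 * r - (a - b)\<^sup>2"
    by (subst variance_eq) (simp_all add: dif2 defs)
  finally have "0 \<le> \<gamma> * (p + q - 2 * r - (a - b)\<^sup>2)" using \<open>0 \<le> \<gamma>\<close> by simp
  then show ?thesis unfolding mX mY mM
    by (simp add: power2_eq_square field_simps)
qed

lemma mean_variance_tendsto:
  assumes [measurable]: "\<And>n. X n \<in> borel_measurable M" "Y \<in> borel_measurable M" "W \<in> borel_measurable M"
    and W: "integrable M (\<lambda>x. (W x)\<^sup>2)" and bd: "\<And>n. AE x in M. \<bar>X n x\<bar> \<le> W x"
    and lim: "AE x in M. (\<lambda>n. X n x) \<longlonglongrightarrow> Y x"
  shows "(\<lambda>n. mean_variance M \<gamma> (X n)) \<longlonglongrightarrow> mean_variance M \<gamma> Y"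
proof -
  have W1: "integrable M W" by (rule square_integrable_imp_integrable[OF _ W]) simp
  have bdY: "AE x in M. \<bar>Y x\<bar> \<le> W x"
    using lim AE_all_countable[THEN iffD2, OF allI, OF bd]
    by eventually_elim (rule LIMSEQ_le_const2[OF tendsto_rabs], auto)
  have X2: "integrable M (\<lambda>x. (X n x)\<^sup>2)" for n
    by (rule integrable_of_square_dominated[OF _ W bd]) simp
  have Y2: "integrable M (\<lambda>x. (Y x)\<^sup>2)"
    by (rule integrable_of_square_dominated[OF _ W bdY]) simp
  have "(\<lambda>n. expectation (X n)) \<longlonglongrightarrow> expectation Y"
    by (rule integral_dominated_convergence[where w=W]) (use W1 bd lim in auto)
  moreover have "(\<lambda>n. expectation (\<lambda>x. (X n x)\<^sup>2)) \<longlonglongrightarrow> expectation (\<lambda>x. (Y x)\<^sup>2)"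
  proof (rule integral_dominated_convergence[where w="\<lambda>x. (W x)\<^sup>2"])
    show "AE x in M. (\<lambda>n. (X n x)\<^sup>2) \<longlonglongrightarrow> (Y x)\<^sup>2"
      using lim by eventually_elim (rule tendsto_power)
    show "AE x in M. norm ((X n x)\<^sup>2) \<le> (W x)\<^sup>2" for n
      using bd[of n] by eventually_elim (auto simp: abs_le_square_iff[symmetric])
  qed (use W in auto)
  ultimately show ?thesis
    by (simp add: mean_variance_eq X2 Y2) (intro tendsto_intros)
qed

end

section \<open>Maximizers of midpoint concave functionals\<close>

text \<open>The almost maximizers of level \<open>1/n\<close> form decreasing sets \<open>A n\<close> that are closed under midpoints.
  Let \<open>d n\<close> be the infimum of the squared \<open>L\<^sup>2\<close> norm over \<open>A n\<close>, an increasing and bounded sequence.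
  If \<open>f n \<in> A n\<close> almost attains \<open>d n\<close>, the parallelogram law bounds the squared distance of
  \<open>f n\<close> and \<open>f m\<close> by a multiple of \<open>\<bar>d m - d n\<bar>\<close> plus a small error, because their midpoint, which
  lies in \<open>A (min n m)\<close>, cannot have a much smaller norm. So \<open>f\<close> is Cauchy, and a subsequence
  converges almost everywhere, to a maximizer.\<close>

proposition midpoint_concave_attains_max:
  fixes C :: "('b \<Rightarrow> real) set" and J :: "('b \<Rightarrow> real) \<Rightarrow> real" and w :: "'b \<Rightarrow> real"
  assumes fin: "finite_measure M" and ne: "C \<noteq> {}"
    and meas: "\<And>h. h \<in> C \<Longrightarrow> h \<in> borel_measurable M"
    and dom: "\<And>h. h \<in> C \<Longrightarrow> AE x in M. \<bar>h x\<bar> \<le> w x"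
    and w: "integrable M (\<lambda>x. (w x)\<^sup>2)"
    and mid: "\<And>h k. h \<in> C \<Longrightarrow> k \<in> C \<Longrightarrow> (\<lambda>x. (h x + k x) / 2) \<in> C"
    and conc: "\<And>h k. h \<in> C \<Longrightarrow> k \<in> C \<Longrightarrow> J h + J k \<le> 2 * J (\<lambda>x. (h x + k x) / 2)"
    and bdd: "bdd_above (J ` C)"
    and closed: "\<And>f g. (\<And>n::nat. f n \<in> C) \<Longrightarrow> g \<in> borel_measurable M \<Longrightarrow>
      AE x in M. (\<lambda>n. f n x) \<longlonglongrightarrow> g x \<Longrightarrow> g \<in> C"
    and cont: "\<And>f g. (\<And>n::nat. f n \<in> C) \<Longrightarrow> g \<in> C \<Longrightarrow>
      AE x in M. (\<lambda>n. f n x) \<longlonglongrightarrow> g x \<Longrightarrow> (\<lambda>n. J (f n)) \<longlonglongrightarrow> J g"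
  shows "\<exists>g\<in>C. \<forall>h\<in>C. J h \<le> J g"
proof -
  interpret finite_measure M by (rule fin)
  define s where "s = (SUP h\<in>C. J h)"
  define A where "A n = {h \<in> C. s - 1 / Suc n \<le> J h}" for n
  define N :: "('b \<Rightarrow> real) \<Rightarrow> real" where "N h = (\<integral>x. (h x)\<^sup>2 \<partial>M)" for h
  define d where "d n = (INF h\<in>A n. N h)" for n
  have le_s: "J h \<le> s" if "h \<in> C" for h
    unfolding s_def by (rule cSUP_upper[OF that bdd])
  have AC: "h \<in> C" if "h \<in> A n" for h n using that by (simp add: A_def)
  have Ane: "A n \<noteq> {}" for n
  proof -
    have "s - 1 / Suc n < s" by simp
    then obtain h where "h \<in> C" "s - 1 / Suc n < J h"
      unfolding s_def less_cSUP_iff[OF ne bdd] by auto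
    then show ?thesis by (auto simp: A_def intro!: exI[of _ h])
  qed
  have Amono: "A m \<subseteq> A n" if "n \<le> m" for n m
  proof -
    have "1 / real (Suc m) \<le> 1 / real (Suc n)" using that by (simp add: frac_le)
    then show ?thesis unfolding A_def by (smt (verit) Collect_mono)
  qed
  have Amid: "(\<lambda>x. (h x + k x) / 2) \<in> A n" if "h \<in> A n" "k \<in> A n" for h k n
    using that mid conc[of h k] by (auto simp: A_def)
  have sq: "integrable M (\<lambda>x. (h x)\<^sup>2)" if "h \<in> C" for h
    by (rule integrable_of_square_dominated[OF meas[OF that] w dom[OF that]])
  have N0: "0 \<le> N h" for h unfolding N_def by simp
  have Nle: "N h \<le> N w" if "h \<in> C" for h
    unfolding N_def
    by (rule integral_mono_AE[OF sq[OF that] w])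
      (use dom[OF that] in \<open>eventually_elim, auto simp: abs_le_square_iff[symmetric]\<close>)
  have bb: "bdd_below (N ` A n)" for n
    by (rule bdd_belowI[of _ 0]) (use N0 in auto)
  have dle: "d n \<le> N h" if "h \<in> A n" for n h
    unfolding d_def by (rule cINF_lower[OF bb that])
  have dmono: "d n \<le> d m" if "n \<le> m" for n m
    unfolding d_def by (rule cINF_superset_mono[OF Ane bb Amono[OF that]]) simp
  have dbd: "d n \<le> N w" for n
    using Ane[of n] dle[of _ n] Nle AC order_trans by (metis ex_in_conv)
  have "\<exists>h. h \<in> A n \<and> N h < d n + 1 / Suc n" for n
  proof -
    have "(INF h\<in>A n. N h) < d n + 1 / Suc n" by (simp add: d_def[symmetric])
    then show ?thesis unfolding cINF_less_iff[OF Ane bb] by auto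
  qed
  then obtain f where fA: "\<And>n. f n \<in> A n" and fN: "\<And>n. N (f n) < d n + 1 / Suc n"
    by metis
  have fC: "f n \<in> C" for n using AC fA by blast
  note fm[measurable] = meas[OF fC]
  \<comment> \<open>The parallelogram law; the midpoint belongs to \<open>A n\<close>, so its squared norm is at least \<open>d n\<close>.\<close>
  have par: "(\<integral>x. (f n x - f m x)\<^sup>2 \<partial>M) \<le> 2 * (d m - d n) + 4 * (1 / Suc n)" if "n \<le> m" for n m
  proof -
    let ?h = "\<lambda>x. (f n x + f m x) / 2"
    have "?h \<in> A n" using fA[of n] fA[of m] Amono[OF that] Amid by blast
    then have h: "d n \<le> N ?h" "?h \<in> C" using dle AC by auto
    have "(f n x - f m x)\<^sup>2 = 2 * (f n x)\<^sup>2 + 2 * (f m x)\<^sup>2 - 4 * (?h x)\<^sup>2" for x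
      by (simp add: power2_eq_square field_simps)
    then have "(\<integral>x. (f n x - f m x)\<^sup>2 \<partial>M) = 2 * N (f n) + 2 * N (f m) - 4 * N ?h"
      using sq[OF fC, of n] sq[OF fC, of m] sq[OF h(2)] by (simp add: N_def del: power_divide)
    moreover have "1 / real (Suc m) \<le> 1 / real (Suc n)" using that by (simp add: frac_le)
    ultimately show ?thesis using fN[of n] fN[of m] h(1) by argo
  qed
  have L1: "integrable M (f n)" for n
    by (rule square_integrable_imp_integrable[OF fm sq[OF fC]])
  have "incseq d" using dmono by (simp add: incseq_def)
  then have "convergent d" using dbd
    by (metis incseq_convergent convergentI)
  then have dC: "Cauchy d" by (rule convergent_Cauchy)
  define V where "V = measure M (space M)"
  have sqC: "\<exists>n0. \<forall>n\<ge>n0. \<forall>m\<ge>n0. (\<integral>x. (f n x - f m x)\<^sup>2 \<partial>M) < e" if "0 < e" for e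
  proof -
    obtain n1 where n1: "\<forall>n\<ge>n1. \<forall>m\<ge>n1. \<bar>d n - d m\<bar> < e / 4"
      using dC[unfolded Cauchy_iff real_norm_def, THEN spec[of _ "e / 4"]] \<open>0 < e\<close> by auto
    obtain n2 where n2: "1 / Suc n2 < e / 8" using nat_approx_posE[of "e / 8"] \<open>0 < e\<close> by auto
    have *: "(\<integral>x. (f n x - f m x)\<^sup>2 \<partial>M) < e" if "max n1 n2 \<le> n" "n \<le> m" for n m
    proof -
      have "1 / real (Suc n) \<le> 1 / real (Suc n2)" using that by (simp add: frac_le)
      moreover have "\<bar>d m - d n\<bar> < e / 4" using n1 that by simp
      ultimately show ?thesis using par[OF that(2)] n2 by argo
    qed
    have "(\<integral>x. (f n x - f m x)\<^sup>2 \<partial>M) < e" if "max n1 n2 \<le> n" "max n1 n2 \<le> m" for n m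
      using *[of n m] *[of m n] that power2_commute[of "f n _" "f m _"]
      by (metis (no_types, lifting) Bochner_Integration.integral_cong nle_le)
    then show ?thesis by blast
  qed
  have L1C: "\<exists>n0. \<forall>n\<ge>n0. \<forall>m\<ge>n0. (\<integral>x. norm (f n x - f m x) \<partial>M) < e" if "0 < e" for e
  proof -
    \<comment> \<open>Young: \<open>\<bar>u\<bar> \<le> a + u\<^sup>2 / a\<close>; the constant part integrates to less than \<open>e / 2\<close>.\<close>
    define a where "a = e / (2 * (V + 1))"
    have V: "0 \<le> V" by (simp add: V_def)
    then have a: "0 < a" "a * V < e / 2" using that by (auto simp: a_def field_simps)
    obtain n0 where n0: "\<And>n m. n0 \<le> n \<Longrightarrow> n0 \<le> m \<Longrightarrow> (\<integral>x. (f n x - f m x)\<^sup>2 \<partial>M) < a * (e / 2)"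
      using sqC[of "a * (e / 2)"] a(1) \<open>0 < e\<close> by auto
    have "(\<integral>x. norm (f n x - f m x) \<partial>M) < e" if nm: "n0 \<le> n" "n0 \<le> m" for n m
    proof -
      have sqd: "integrable M (\<lambda>x. (f n x - f m x)\<^sup>2)"
        using integrable_mult_of_squares[OF fm fm sq[OF fC] sq[OF fC], of n m]
          sq[OF fC, of n] sq[OF fC, of m]
        by (simp add: power2_diff mult.assoc)
      have "\<bar>u\<bar> \<le> a + u\<^sup>2 / a" for u :: real
      proof -
        have "0 \<le> (a - \<bar>u\<bar>)\<^sup>2" by simp
        then have "2 * (a * \<bar>u\<bar>) \<le> a\<^sup>2 + u\<^sup>2" by (simp add: power2_diff)
        moreover have "0 \<le> a * \<bar>u\<bar>" using a(1) by simp
        ultimately have "a * \<bar>u\<bar> \<le> a\<^sup>2 + u\<^sup>2" by linarith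
        then show ?thesis using a(1) by (simp add: field_simps power2_eq_square)
      qed
      then have "(\<integral>x. norm (f n x - f m x) \<partial>M) \<le> (\<integral>x. a + (f n x - f m x)\<^sup>2 / a \<partial>M)"
        using L1 sqd by (intro integral_mono) auto
      also have "\<dots> = a * V + (\<integral>x. (f n x - f m x)\<^sup>2 \<partial>M) / a"
        using sqd by (simp add: V_def)
      also have "\<dots> < e / 2 + e / 2"
        using n0[OF nm] a by (intro add_strict_mono) (auto simp: field_simps)
      finally show ?thesis by simp
    qed
    then show ?thesis by blast
  qed
  obtain r where r: "strict_mono r" and rC: "AE x in M. Cauchy (\<lambda>i. f (r i) x)"
    using cauchy_L1_AE_cauchy_subseq[of M f] L1 L1C by auto
  define g where "g x = lim (\<lambda>i. f (r i) x)" for x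
  have gm: "g \<in> borel_measurable M" unfolding g_def by measurable
  have lim: "AE x in M. (\<lambda>i. f (r i) x) \<longlonglongrightarrow> g x"
    using rC by eventually_elim (simp add: g_def Cauchy_convergent_iff convergent_LIMSEQ_iff)
  have gC: "g \<in> C" by (rule closed[OF fC gm lim])
  have "(\<lambda>i. J (f (r i))) \<longlonglongrightarrow> J g" by (rule cont[OF fC gC lim])
  moreover have "(\<lambda>i. s - 1 / Suc (r i)) \<longlonglongrightarrow> s - 0"
    by (intro tendsto_diff tendsto_const LIMSEQ_subseq_LIMSEQ[OF lim_inverse_n'[THEN LIMSEQ_Suc] r, unfolded o_def])
  moreover have "s - 1 / Suc (r i) \<le> J (f (r i))" for i using fA[of "r i"] by (simp add: A_def)
  ultimately have "s \<le> J g" by (metis (no_types, lifting) LIMSEQ_le diff_zero)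
  then show ?thesis using gC le_s by (meson order_trans)
qed

section \<open>Two comparison principles\<close>

text \<open>Mean reversion cannot push the solution below \<open>0\<close>, although \<open>y\<close> may jump upwards with \<open>A\<close> and no
  derivative is at hand: after the last time \<open>s\<close> at which \<open>y\<close> is nonnegative, the drift
  \<open>- \<beta> y\<close> is positive and \<open>A\<close> only increases. Since \<open>y\<close> need not be continuous, \<open>s\<close> is a supremum
  that may not be attained; the inequality at \<open>s\<close> is the limit of the inequalities at earlier times.\<close>

lemma decay_equation_nonneg:
  fixes y A :: "real \<Rightarrow> real"
  assumes "0 \<le> \<beta>" and "0 \<le> t" and int: "y integrable_on {0..t}"
    and eq: "\<And>u. 0 \<le> u \<Longrightarrow> u \<le> t \<Longrightarrow> y u = A u - \<beta> * integral {0..u} y"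
    and A0: "0 \<le> A 0" and A_mono: "\<And>u. 0 \<le> u \<Longrightarrow> u \<le> t \<Longrightarrow> A u \<le> A t"
  shows "0 \<le> y t"
proof (rule ccontr)
  assume neg: "\<not> 0 \<le> y t"
  define I where "I u = integral {0..u} y" for u
  define S where "S = {u \<in> {0..t}. 0 \<le> y u}"
  define s where "s = Sup S"
  have "y 0 = A 0" using eq[of 0] \<open>0 \<le> t\<close> by simp
  then have S: "S \<noteq> {}" "bdd_above S" using A0 \<open>0 \<le> t\<close> by (auto simp: S_def)
  have "closed {u \<in> {0..t}. - \<beta> * (I t - I u) \<le> y t}"
    unfolding I_def
    by (intro continuous_closed_preimage_constant continuous_on_closed_Collect_le
        continuous_intros indefinite_integral_continuous_1 int closed_atLeastAtMost)
  moreover have "- \<beta> * (I t - I u) \<le> y t" if "u \<in> S" for u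
  proof -
    have u: "0 \<le> u" "u \<le> t" "0 \<le> y u" using that by (auto simp: S_def)
    have "y t - y u = A t - A u - \<beta> * (I t - I u)"
      using eq[of u] eq[of t] u by (simp add: I_def algebra_simps)
    then show ?thesis using A_mono[of u] u by linarith
  qed
  then have "S \<subseteq> {u \<in> {0..t}. - \<beta> * (I t - I u) \<le> y t}" by (auto simp: S_def)
  moreover have "s \<in> closure S" unfolding s_def by (rule closure_contains_Sup[OF S])
  ultimately have "s \<in> {u \<in> {0..t}. - \<beta> * (I t - I u) \<le> y t}"
    using closure_minimal subsetD by metis
  then have s: "0 \<le> s" "s \<le> t" "- \<beta> * (I t - I s) \<le> y t" by auto
  have after: "y u < 0" if "s < u" "u \<le> t" for u
    using cSup_upper[of u S] S(2) that s(1) by (force simp: S_def s_def)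
  have "integral {s..t} y = integral {s..t} (\<lambda>u. if u = s then 0 else y u)"
    by (rule integral_spike[of "{s}"]) auto
  also have "\<dots> \<le> integral {s..t} (\<lambda>u. 0)"
  proof (rule integral_le)
    have "y integrable_on {s..t}"
      by (rule integrable_on_subinterval[OF int]) (use s in auto)
    then show "(\<lambda>u. if u = s then 0 else y u) integrable_on {s..t}"
      by (rule integrable_spike[of _ _ "{s}"]) auto
    show "(if u = s then 0 else y u) \<le> 0" if "u \<in> {s..t}" for u
      using after[of u] that by auto
  qed (rule integrable_0)
  finally have "integral {s..t} y \<le> 0" by simp
  moreover have "I s + integral {s..t} y = I t"
    unfolding I_def by (rule Henstock_Kurzweil_Integration.integral_combine) (use s int in auto)
  ultimately have "I t - I s \<le> 0" by simp
  then show False using s(3) neg \<open>0 \<le> \<beta>\<close>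
    by (smt (verit) mult_nonneg_nonneg mult_minus_left mult_minus_right)
qed

text \<open>With \<open>M\<close> the supremum of \<open>exp (- 2 c t) (1 + v t)\<close>, the integral inequality gives \<open>M \<le> 1 + M / 2\<close>.
  The bound \<open>B\<close> serves only to make \<open>M\<close> finite and does not enter the conclusion.\<close>

lemma gronwall_ennreal:
  fixes v :: "real \<Rightarrow> ennreal"
  assumes c: "0 < c" and T: "0 \<le> T"
    and v: "\<And>t. 0 \<le> t \<Longrightarrow> t \<le> T \<Longrightarrow> v t \<le> (\<integral>\<^sup>+s\<in>{0..t}. ennreal c * (1 + v s) \<partial>lborel)"
    and B: "\<And>t. 0 \<le> t \<Longrightarrow> t \<le> T \<Longrightarrow> v t \<le> B" "B < \<infinity>"
  shows "v T \<le> ennreal (2 * exp (2 * c * T))"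
proof -
  define M where "M = (SUP t\<in>{0..T}. ennreal (exp (- 2 * c * t)) * (1 + v t))"
  have "M \<le> 1 + B" unfolding M_def
  proof (rule SUP_least)
    fix t assume t: "t \<in> {0..T}"
    have "ennreal (exp (- 2 * c * t)) * (1 + v t) \<le> 1 * (1 + B)"
      using t c B(1)[of t] by (intro mult_mono add_mono) auto
    then show "ennreal (exp (- 2 * c * t)) * (1 + v t) \<le> 1 + B" by simp
  qed
  also have "\<dots> < \<infinity>" using B(2) by simp
  finally obtain m where m: "M = ennreal m" "0 \<le> m"
    by (metis ennreal_cases infinity_ennreal_def less_irrefl)
  have ee: "ennreal (exp (2 * c * s)) * ennreal (exp (- 2 * c * s)) = 1" for s
    by (simp add: ennreal_mult[symmetric] exp_add[symmetric])
  have w: "1 + v s \<le> ennreal (exp (2 * c * s)) * M" if "0 \<le> s" "s \<le> T" for s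
  proof -
    have "ennreal (exp (- 2 * c * s)) * (1 + v s) \<le> M"
      unfolding M_def by (rule SUP_upper) (use that in auto)
    then have "ennreal (exp (2 * c * s)) * (ennreal (exp (- 2 * c * s)) * (1 + v s))
        \<le> ennreal (exp (2 * c * s)) * M" by (rule mult_left_mono) simp
    then show ?thesis by (simp only: mult.assoc[symmetric] ee mult_1_left)
  qed
  have step: "v t \<le> ennreal (m * exp (2 * c * t) / 2)" if t: "0 \<le> t" "t \<le> T" for t
  proof -
    have "v t \<le> (\<integral>\<^sup>+s\<in>{0..t}. ennreal c * (1 + v s) \<partial>lborel)" by (rule v[OF t])
    also have "\<dots> \<le> (\<integral>\<^sup>+s\<in>{0..t}. ennreal (c * exp (2 * c * s) * m) \<partial>lborel)"
    proof (rule nn_integral_mono)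
      fix s :: real
      show "ennreal c * (1 + v s) * indicator {0..t} s
          \<le> ennreal (c * exp (2 * c * s) * m) * indicator {0..t} s"
        using mult_left_mono[OF w, of s "ennreal c"] c m t
        by (auto simp: indicator_def ennreal_mult mult.assoc)
    qed
    also have "\<dots> = ennreal (m * exp (2 * c * t) / 2 - m * exp (2 * c * 0) / 2)"
      using c m(2) t
      by (intro nn_integral_FTC_Icc[where F="\<lambda>s. m * exp (2 * c * s) / 2"])
        (auto intro!: derivative_eq_intros)
    also have "\<dots> \<le> ennreal (m * exp (2 * c * t) / 2)"
      using m(2) by (intro ennreal_leI) simp
    finally show ?thesis .
  qed
  have "M \<le> ennreal (1 + m / 2)" unfolding M_def
  proof (rule SUP_least)
    fix t assume t: "t \<in> {0..T}"
    have "ennreal (exp (- 2 * c * t)) * (1 + v t)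
        \<le> ennreal (exp (- 2 * c * t)) * (1 + ennreal (m * exp (2 * c * t) / 2))"
      using step[of t] t by (intro mult_left_mono add_left_mono) auto
    also have "\<dots> = ennreal (exp (- 2 * c * t) * (1 + m * exp (2 * c * t) / 2))"
      using m(2) by (simp add: ennreal_mult ennreal_plus)
    also have "\<dots> \<le> ennreal (1 + m / 2)"
    proof (rule ennreal_leI)
      have "exp (- 2 * c * t) * (1 + m * exp (2 * c * t) / 2)
          = exp (- 2 * c * t) + m / 2 * (exp (- 2 * c * t) * exp (2 * c * t))"
        by (simp add: algebra_simps)
      also have "\<dots> = exp (- 2 * c * t) + m / 2" by (simp add: exp_add[symmetric])
      also have "\<dots> \<le> 1 + m / 2" using c t by simp
      finally show "exp (- 2 * c * t) * (1 + m * exp (2 * c * t) / 2) \<le> 1 + m / 2" .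
    qed
    finally show "ennreal (exp (- 2 * c * t)) * (1 + v t) \<le> ennreal (1 + m / 2)" .
  qed
  then have "m \<le> 2" using m by (simp del: ennreal_plus)
  have "v T \<le> 1 + v T" by simp
  also have "\<dots> \<le> ennreal (exp (2 * c * T)) * M" using w[of T] T by simp
  also have "\<dots> \<le> ennreal (2 * exp (2 * c * T))"
    using m \<open>m \<le> 2\<close> by (simp add: ennreal_mult[symmetric] mult.commute)
  finally show ?thesis .
qed

section \<open>The predictable sigma algebra\<close>

context usual_filtered_prob_space
begin

lemma space_F: "0 \<le> t \<Longrightarrow> space (F t) = space Q"
  using subalg by (simp add: subalgebra_def)

lemma space_predictable: "space (predictable_sigma Q F) = space Q \<times> {0..}"
  unfolding predictable_sigma_def by (rule space_measure_of_conv)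

lemma predictable_gen:
  "{A \<times> {0} | A. A \<in> sets (F 0)} \<union> {A \<times> {s<..t} | A s t. 0 \<le> s \<and> s \<le> t \<and> A \<in> sets (F s)}
    \<subseteq> Pow (space Q \<times> {0..})"
proof -
  have "A \<subseteq> space Q" if "A \<in> sets (F s)" "0 \<le> s" for A s
    using sets.sets_into_space[OF that(1)] space_F[OF that(2)] by simp
  then show ?thesis by fastforce
qed

lemma sets_predictable_generator:
  "0 \<le> s \<Longrightarrow> s \<le> t \<Longrightarrow> A \<in> sets (F s) \<Longrightarrow> A \<times> {s<..t} \<in> sets (predictable_sigma Q F)"
  unfolding predictable_sigma_def sets_measure_of[OF predictable_gen] by blast+

text \<open>The generators are bounded in time; open half-lines are countable unions of them.\<close>

lemma sets_predictable_after:
  assumes "0 \<le> s" and "A \<in> sets (F s)"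
  shows "A \<times> {s<..} \<in> sets (predictable_sigma Q F)"
proof -
  have "A \<times> {s<..} = (\<Union>n::nat. A \<times> {s<..s + real n})"
  proof (intro equalityI subsetI)
    fix x assume x: "x \<in> A \<times> {s<..}"
    obtain n :: nat where "snd x - s \<le> real n" using real_arch_simple by blast
    then show "x \<in> (\<Union>n::nat. A \<times> {s<..s + real n})"
      using x by (auto simp: mem_Times_iff intro!: exI[of _ n])
  qed auto
  also have "\<dots> \<in> sets (predictable_sigma Q F)"
    using assms by (intro sets.countable_UN subsetI) (auto intro!: sets_predictable_generator)
  finally show ?thesis .
qed

lemma predictable_time: "snd \<in> borel_measurable (predictable_sigma Q F)"
proof (rule borel_measurableI_greater)
  fix a :: real
  have "{w \<in> space (predictable_sigma Q F). a < snd w} =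
      (if a < 0 then space (predictable_sigma Q F) else space Q \<times> {a<..})"
    by (auto simp: space_predictable)
  also have "\<dots> \<in> sets (predictable_sigma Q F)"
    using sets_predictable_after[of a "space Q"] space_F[of a] sets.top[of "F a"]
    by (cases "a < 0") (simp_all del: sets.top)
  finally show "{w \<in> space (predictable_sigma Q F). a < snd w} \<in> sets (predictable_sigma Q F)" .
qed

lemma predictable_section:
  assumes "\<omega> \<in> space Q"
  shows "(\<lambda>s. (\<omega>, s)) \<in> measurable Rplus (predictable_sigma Q F)"
  unfolding predictable_sigma_def
proof (rule measurable_measure_of[OF predictable_gen])
  show "(\<lambda>s. (\<omega>, s)) \<in> space Rplus \<rightarrow> space Q \<times> {0..}"
    using assms by (auto simp: space_restrict_space)
  fix Y assume "Y \<in> {A \<times> {0} | A. A \<in> sets (F 0)} \<union>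
      {A \<times> {s<..t} | A s t. 0 \<le> s \<and> s \<le> t \<and> A \<in> sets (F s)}"
  then consider (init) A where "Y = A \<times> {0}" | (later) A s t where "Y = A \<times> {s<..t}"
    by blast
  then have "\<exists>A B. Y = A \<times> B \<and> B \<in> sets (borel :: real measure)"
  proof cases
    case init
    then show ?thesis using borel_closed[OF closed_singleton[of "0::real"]] by blast
  next
    case later
    then show ?thesis using greaterThanAtMost_borel[where 'a=real] by blast
  qed
  then obtain A B where Y: "Y = A \<times> B" and B: "B \<in> sets (borel :: real measure)" by blast
  have "(\<lambda>s. (\<omega>, s)) -` Y \<inter> space Rplus = (if \<omega> \<in> A then B \<inter> {0..} else {})"
    using Y by (auto simp: space_restrict_space)
  also have "\<dots> \<in> sets Rplus" using B by (auto simp: sets_restrict_space_iff)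
  finally show "(\<lambda>s. (\<omega>, s)) -` Y \<inter> space Rplus \<in> sets Rplus" .
qed

end

section \<open>Paths of marked point processes\<close>

text \<open>The running loss \<open>L(s-)\<close>, with values in \<open>ennreal\<close> so that it is defined and measurable also on
  the exceptional paths on which infinitely many losses occur before \<open>s\<close>.\<close>

definition losses_before :: "(nat \<Rightarrow> 'a \<Rightarrow> ennreal) \<Rightarrow> (nat \<Rightarrow> 'a \<Rightarrow> real) \<Rightarrow> real \<Rightarrow> 'a \<Rightarrow> ennreal"
  where "losses_before \<tau> Z s \<omega> = (\<Sum>i. if \<tau> i \<omega> < ennreal s then ennreal (Z i \<omega>) else 0)"

text \<open>The properties that almost every path of a marked point process has, for arguments that fix
  the path.\<close>

definition regular_path :: "(nat \<Rightarrow> 'a \<Rightarrow> ennreal) \<Rightarrow> (nat \<Rightarrow> 'a \<Rightarrow> real) \<Rightarrow> 'a \<Rightarrow> bool"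
  where "regular_path \<tau> Z \<omega> \<longleftrightarrow> (\<forall>i. 0 \<le> Z i \<omega>) \<and> 0 < \<tau> 0 \<omega> \<and>
       (\<forall>i. \<tau> i \<omega> \<le> \<tau> (Suc i) \<omega> \<and> (\<tau> i \<omega> < \<infinity> \<longrightarrow> \<tau> i \<omega> < \<tau> (Suc i) \<omega>)) \<and>
       (\<lambda>i. \<tau> i \<omega>) \<longlonglongrightarrow> \<infinity>"

lemma regular_path_mono: "regular_path \<tau> Z \<omega> \<Longrightarrow> i \<le> j \<Longrightarrow> \<tau> i \<omega> \<le> \<tau> j \<omega>"
  by (rule lift_Suc_mono_le[of "\<lambda>i. \<tau> i \<omega>"]) (auto simp: regular_path_def)

lemma regular_path_strict:
  assumes r: "regular_path \<tau> Z \<omega>" and fin: "\<tau> i \<omega> < \<infinity>"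
  shows "\<tau> j \<omega> < \<tau> i \<omega> \<longleftrightarrow> j < i"
proof
  assume "\<tau> j \<omega> < \<tau> i \<omega>"
  then show "j < i" using regular_path_mono[OF r, of i j] by (meson leD leI)
next
  assume "j < i"
  then have le: "\<tau> (Suc j) \<omega> \<le> \<tau> i \<omega>" by (intro regular_path_mono[OF r]) simp
  have "\<tau> j \<omega> \<le> \<tau> (Suc j) \<omega>" by (intro regular_path_mono[OF r]) simp
  then have "\<tau> j \<omega> < \<infinity>" using le fin by simp
  then have "\<tau> j \<omega> < \<tau> (Suc j) \<omega>" using r by (simp add: regular_path_def)
  then show "\<tau> j \<omega> < \<tau> i \<omega>" using le by simp
qed

text \<open>As the times increase to infinity, the losses that occur before or up to a time have the
  numbers \<open>0, ..., n - 1\<close>. \<open>P\<close> stands for both kinds of bound.\<close>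

lemma regular_path_initial_segment:
  assumes r: "regular_path \<tau> Z \<omega>" and dn: "\<And>i j. j \<le> i \<Longrightarrow> P (\<tau> i \<omega>) \<Longrightarrow> P (\<tau> j \<omega>)"
    and bd: "\<And>x. P x \<Longrightarrow> x \<le> ennreal t"
  shows "\<exists>n. \<forall>i. P (\<tau> i \<omega>) \<longleftrightarrow> i < n"
proof -
  have "(\<lambda>i. \<tau> i \<omega>) \<longlonglongrightarrow> \<infinity>" using r by (simp add: regular_path_def)
  then have "eventually (\<lambda>i. ennreal t < \<tau> i \<omega>) sequentially"
    by (rule order_tendstoD) simp
  then have ex: "\<exists>i. \<not> P (\<tau> i \<omega>)"
    using bd by (metis eventually_sequentially leD order_refl)
  define n where "n = (LEAST i. \<not> P (\<tau> i \<omega>))"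
  have "P (\<tau> i \<omega>)" if "i < n" for i using not_less_Least[of i] that by (auto simp: n_def)
  moreover have "\<not> P (\<tau> n \<omega>)" unfolding n_def by (rule LeastI_ex[OF ex])
  then have "\<not> P (\<tau> i \<omega>)" if "n \<le> i" for i using dn[OF that] by blast
  ultimately show ?thesis by (metis leI)
qed

lemma regular_path_before:
  assumes r: "regular_path \<tau> Z \<omega>"
  obtains n where "\<And>i. \<tau> i \<omega> < ennreal s \<longleftrightarrow> i < n"
  using regular_path_initial_segment[OF r, of "\<lambda>x. x < ennreal s" s] regular_path_mono[OF r]
  by (metis order_less_imp_le order_le_less_trans)

lemma regular_path_upto:
  assumes r: "regular_path \<tau> Z \<omega>"
  obtains n where "\<And>i. \<tau> i \<omega> \<le> ennreal s \<longleftrightarrow> i < n"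
  using regular_path_initial_segment[OF r, of "\<lambda>x. x \<le> ennreal s" s] regular_path_mono[OF r]
  by (metis order_trans)

lemma losses_before_eq_sum:
  assumes "\<And>i. \<tau> i \<omega> < ennreal s \<longleftrightarrow> i < n" and "\<And>i. 0 \<le> Z i \<omega>"
  shows "losses_before \<tau> Z s \<omega> = ennreal (\<Sum>i<n. Z i \<omega>)"
proof -
  have "losses_before \<tau> Z s \<omega> = (\<Sum>i<n. if \<tau> i \<omega> < ennreal s then ennreal (Z i \<omega>) else 0)"
    unfolding losses_before_def by (rule suminf_finite) (use assms(1) in auto)
  also have "\<dots> = (\<Sum>i<n. ennreal (Z i \<omega>))" using assms(1) by (intro sum.cong) auto
  also have "\<dots> = ennreal (\<Sum>i<n. Z i \<omega>)" using assms(2) by (simp add: sum_ennreal)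
  finally show ?thesis .
qed

text \<open>Only finitely many losses occur before \<open>t\<close>, and all of them occur before any \<open>s < t\<close> that is close
  enough to \<open>t\<close>.\<close>

lemma losses_before_left_continuous:
  assumes r: "regular_path \<tau> Z \<omega>" and "0 < t"
  shows "eventually (\<lambda>s. losses_before \<tau> Z s \<omega> = losses_before \<tau> Z t \<omega>) (at_left t)"
proof -
  obtain n where n: "\<And>i. \<tau> i \<omega> < ennreal t \<longleftrightarrow> i < n"
    using regular_path_before[OF r, of t] by blast
  have "eventually (\<lambda>s. \<forall>i\<in>{..<n}. \<tau> i \<omega> < ennreal s) (at_left t)"
  proof (rule eventually_ball_finite[OF finite_lessThan], intro ballI)
    fix i assume "i \<in> {..<n}"
    then have i: "\<tau> i \<omega> < ennreal t" using n by simp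
    then obtain x where x: "\<tau> i \<omega> = ennreal x" "0 \<le> x"
      by (metis ennreal_cases ennreal_less_top order_less_trans less_irrefl)
    then have "x < t" using i by (simp add: ennreal_less_iff)
    then have "eventually (\<lambda>s. x < s) (at_left t)"
      by (intro eventually_at_leftI[of x]) auto
    then show "eventually (\<lambda>s. \<tau> i \<omega> < ennreal s) (at_left t)"
      by eventually_elim (use x in \<open>simp add: ennreal_less_iff\<close>)
  qed
  moreover have "eventually (\<lambda>s. s < t) (at_left t)" by (simp add: eventually_at_filter)
  ultimately show ?thesis
  proof eventually_elim
    case (elim s)
    have "\<tau> i \<omega> < ennreal s \<longleftrightarrow> \<tau> i \<omega> < ennreal t" for i
      using elim n[of i] ennreal_leI[of s t] by (meson lessThan_iff less_imp_le order_less_le_trans)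
    then show ?case by (simp add: losses_before_def)
  qed
qed

context
  fixes \<tau> :: "nat \<Rightarrow> 'a \<Rightarrow> ennreal" and Z :: "nat \<Rightarrow> 'a \<Rightarrow> real" and \<omega> :: 'a
  assumes Z0: "\<And>i. 0 \<le> Z i \<omega>"
begin

lemma point_measurable:
  "(\<lambda>i. (enn2real (\<tau> i \<omega>), Z i \<omega>)) \<in> measurable (count_space A) (Rplus \<Otimes>\<^sub>M Rplus)"
  using Z0 by (simp add: space_pair_measure space_restrict_space)

lemma nn_integral_counting_random_measure:
  assumes "g \<in> borel_measurable (Rplus \<Otimes>\<^sub>M Rplus)"
  shows "integral\<^sup>N (counting_random_measure \<tau> Z \<omega>) g
    = (\<Sum>i. if \<tau> i \<omega> < \<infinity> then g (enn2real (\<tau> i \<omega>), Z i \<omega>) else 0)"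
  unfolding counting_random_measure_def
  by (subst nn_integral_distr)
    (use assms in \<open>auto simp: Z0 space_pair_measure space_restrict_space nn_integral_count_space_indicator
      nn_integral_count_space_nat intro!: suminf_cong nn_integral_cong\<close>)

lemma integral_counting_random_measure:
  fixes g :: "real \<times> real \<Rightarrow> real"
  assumes "g \<in> borel_measurable (Rplus \<Otimes>\<^sub>M Rplus)" and "finite I"
    and "I \<subseteq> {i. \<tau> i \<omega> < \<infinity>}"
    and "\<And>i. \<tau> i \<omega> < \<infinity> \<Longrightarrow> i \<notin> I \<Longrightarrow> g (enn2real (\<tau> i \<omega>), Z i \<omega>) = 0"
  shows "integral\<^sup>L (counting_random_measure \<tau> Z \<omega>) g = (\<Sum>i\<in>I. g (enn2real (\<tau> i \<omega>), Z i \<omega>))"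
proof -
  let ?h = "\<lambda>i. g (enn2real (\<tau> i \<omega>), Z i \<omega>)"
  have fin: "{i \<in> {i. \<tau> i \<omega> < \<infinity>}. ?h i \<noteq> 0} \<subseteq> I" using assms(4) by blast
  have "integral\<^sup>L (counting_random_measure \<tau> Z \<omega>) g = (\<integral>i. ?h i \<partial>count_space {i. \<tau> i \<omega> < \<infinity>})"
    unfolding counting_random_measure_def by (rule integral_distr[OF point_measurable assms(1)])
  also have "\<dots> = (\<Sum>i | i \<in> {i. \<tau> i \<omega> < \<infinity>} \<and> ?h i \<noteq> 0. ?h i)"
    by (rule lebesgue_integral_count_space_finite_support)
      (use finite_subset[OF fin assms(2)] in simp)
  also have "\<dots> = (\<Sum>i\<in>I. ?h i)"
    by (rule sum.mono_neutral_left) (use assms in auto)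
  finally show ?thesis .
qed

end

lemma borel_measurable_fst_Rplus: "fst \<in> borel_measurable (Rplus \<Otimes>\<^sub>M N)"
proof -
  have "(\<lambda>x. x) \<circ> fst \<in> borel_measurable (Rplus \<Otimes>\<^sub>M N)"
    by (rule measurable_comp[OF measurable_fst]) (rule measurable_restrict_space1, simp)
  then show ?thesis by (simp add: comp_def)
qed

lemma borel_measurable_snd_Rplus: "snd \<in> borel_measurable (M \<Otimes>\<^sub>M Rplus)"
proof -
  have "(\<lambda>x. x) \<circ> snd \<in> borel_measurable (M \<Otimes>\<^sub>M Rplus)"
    by (rule measurable_comp[OF measurable_snd]) (rule measurable_restrict_space1, simp)
  then show ?thesis by (simp add: comp_def)
qed

lemma enn2real_less_iff: "x < \<infinity> \<Longrightarrow> enn2real x < t \<longleftrightarrow> x < ennreal t"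
  by (cases x) (auto simp: ennreal_less_iff)

lemma enn2real_le_iff: "x < \<infinity> \<Longrightarrow> 0 \<le> t \<Longrightarrow> enn2real x \<le> t \<longleftrightarrow> x \<le> ennreal t"
  by (cases x) (auto simp: ennreal_le_iff)

lemma integral_losses_before:
  assumes r: "regular_path \<tau> Z \<omega>" and "0 \<le> t"
  shows "(LINT (s, z):{0..<t} \<times> {0..}|counting_random_measure \<tau> Z \<omega>. \<Lambda> * z)
    = \<Lambda> * enn2real (losses_before \<tau> Z t \<omega>)"
proof -
  have Z0: "0 \<le> Z i \<omega>" for i using r by (simp add: regular_path_def)
  obtain n where n: "\<And>i. \<tau> i \<omega> < ennreal t \<longleftrightarrow> i < n"
    using regular_path_before[OF r, of t] by blast
  have fin: "\<tau> i \<omega> < \<infinity>" if "i < n" for i using that n[of i] by (simp add: order_less_trans)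
  note [measurable] = borel_measurable_fst_Rplus borel_measurable_snd_Rplus
  define g :: "real \<times> real \<Rightarrow> real"
    where "g p = (if 0 \<le> fst p \<and> fst p < t \<and> 0 \<le> snd p then \<Lambda> * snd p else 0)" for p
  have g: "g \<in> borel_measurable (Rplus \<Otimes>\<^sub>M Rplus)" unfolding g_def by measurable
  have "(LINT (s, z):{0..<t} \<times> {0..}|counting_random_measure \<tau> Z \<omega>. \<Lambda> * z)
      = integral\<^sup>L (counting_random_measure \<tau> Z \<omega>) g"
    unfolding set_lebesgue_integral_def
    by (rule Bochner_Integration.integral_cong) (auto simp: g_def indicator_def)
  also have "\<dots> = (\<Sum>i<n. g (enn2real (\<tau> i \<omega>), Z i \<omega>))"
    by (rule integral_counting_random_measure[of Z \<omega>, OF Z0 g])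
      (use n fin in \<open>auto simp: g_def enn2real_less_iff\<close>)
  also have "\<dots> = (\<Sum>i<n. \<Lambda> * Z i \<omega>)"
    by (rule sum.cong) (use n fin Z0 in \<open>auto simp: g_def enn2real_less_iff\<close>)
  also have "\<dots> = \<Lambda> * enn2real (losses_before \<tau> Z t \<omega>)"
    using losses_before_eq_sum[of \<tau> \<omega> t n Z] n Z0 by (simp add: sum_nonneg sum_distrib_left)
  finally show ?thesis .
qed

lemma losses_before_finite:
  assumes r: "regular_path \<tau> Z \<omega>"
  shows "losses_before \<tau> Z t \<omega> < \<infinity>"
proof -
  obtain n where n: "\<And>i. \<tau> i \<omega> < ennreal t \<longleftrightarrow> i < n"
    using regular_path_before[OF r, of t] by blast
  show ?thesis using losses_before_eq_sum[of \<tau> \<omega> t n Z] n r by (simp add: regular_path_def)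
qed

lemma losses_before_mono:
  assumes "s \<le> t" shows "losses_before \<tau> Z s \<omega> \<le> losses_before \<tau> Z t \<omega>"
  unfolding losses_before_def
  by (intro suminf_le summableI) (use ennreal_leI[OF assms] order_less_le_trans in auto)

text \<open>The intensity is left continuous because the losses in its equation are summed over \<open>[0, t)\<close>.
  So \<open>x - l\<close> solves a decay equation driven by a nonnegative increasing function, and \<open>x\<close> stays above
  its base level \<open>l\<close>. Then the mean reversion only lowers \<open>x\<close>, and dropping it from the equation
  gives the upper bound.\<close>

lemma hawkes_path_bounds:
  assumes r: "regular_path \<tau> Z \<omega>" and "0 \<le> \<beta>" "0 \<le> \<Lambda>" "l \<le> l0"
    and int: "\<And>t. 0 \<le> t \<Longrightarrow> set_integrable lborel {0..t} (left_lim x)"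
    and eq: "\<And>t. 0 \<le> t \<Longrightarrow> x t = l0 + \<beta> * (LBINT s:{0..t}. l - left_lim x s)
      + (LINT (s, z):{0..<t} \<times> {0..}|counting_random_measure \<tau> Z \<omega>. \<Lambda> * z)"
    and "0 \<le> t"
  shows "left_lim x t = x t" and "l \<le> x t" and "x t \<le> l0 + \<Lambda> * enn2real (losses_before \<tau> Z t \<omega>)"
proof -
  define I where "I u = integral {0..u} (\<lambda>s. l - left_lim x s)" for u
  define J where "J u = enn2real (losses_before \<tau> Z u \<omega>)" for u
  have intl: "set_integrable lborel {0..u} (\<lambda>s. l - left_lim x s)" if "0 \<le> u" for u
  proof (rule set_integral_diff[OF _ int[OF that]])
    have "integrable lborel (indicator {0..u} :: real \<Rightarrow> real)"
      by (rule integrable_real_indicator) (use that in simp_all)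
    then show "set_integrable lborel {0..u} (\<lambda>s. l)" by (simp add: set_integrable_def)
  qed
  have x: "x u = l0 + \<beta> * I u + \<Lambda> * J u" if "0 \<le> u" for u
    using eq[OF that] integral_losses_before[OF r that, of \<Lambda>]
      set_borel_integral_eq_integral(2)[OF intl[OF that]] by (simp add: I_def J_def)
  have left: "left_lim x u = x u" if "0 \<le> u" for u
  proof (cases "u = 0")
    case True then show ?thesis by (simp add: left_lim_def)
  next
    case False
    then have u: "0 < u" using that by simp
    have "continuous_on {0..u} I"
      unfolding I_def
      by (rule indefinite_integral_continuous_1) (rule set_borel_integral_eq_integral(1)[OF intl[OF that]])
    then have "(I \<longlongrightarrow> I u) (at_left u)"
      using u by (simp add: continuous_on_def at_within_Icc_at_left[symmetric])
    then have "((\<lambda>s. l0 + \<beta> * I s + \<Lambda> * J u) \<longlongrightarrow> l0 + \<beta> * I u + \<Lambda> * J u) (at_left u)"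
      by (intro tendsto_intros)
    moreover have "eventually (\<lambda>s. l0 + \<beta> * I s + \<Lambda> * J u = x s) (at_left u)"
    proof -
      have "eventually (\<lambda>s. 0 \<le> s) (at_left u)"
        by (rule eventually_at_leftI[of 0]) (use u in auto)
      with losses_before_left_continuous[OF r u] show ?thesis
        by eventually_elim (simp add: x J_def)
    qed
    ultimately have "(x \<longlongrightarrow> l0 + \<beta> * I u + \<Lambda> * J u) (at_left u)"
      by (rule Lim_transform_eventually)
    then have "(x \<longlongrightarrow> x u) (at_left u)" by (simp only: x[OF that])
    then show ?thesis using u by (simp add: left_lim_def tendsto_Lim)
  qed
  define y where "y u = x u - l" for u
  have I: "I u = - integral {0..u} y" "y integrable_on {0..u}" if "0 \<le> u" for u
  proof -
    have e: "integral {0..u} (\<lambda>s. l - left_lim x s) = integral {0..u} (\<lambda>s. - y s)"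
      by (rule Henstock_Kurzweil_Integration.integral_cong) (simp add: left y_def)
    then show "I u = - integral {0..u} y" by (simp add: I_def)
    have "(\<lambda>s. - (l - left_lim x s)) integrable_on {0..u}"
      by (rule integrable_neg) (rule set_borel_integral_eq_integral(1)[OF intl[OF that]])
    then show "y integrable_on {0..u}"
      by (rule integrable_eq) (simp add: left y_def)
  qed
  have ynn: "0 \<le> y u" if u: "0 \<le> u" for u
  proof (rule decay_equation_nonneg[where y=y and t=u and \<beta>=\<beta> and A="\<lambda>u. l0 - l + \<Lambda> * J u"])
    show "y integrable_on {0..u}" by (rule I(2)[OF u])
    show "y s = l0 - l + \<Lambda> * J s - \<beta> * integral {0..s} y" if "0 \<le> s" for s
      using x[OF that] I(1)[OF that] by (simp add: y_def)
    have "J s \<le> J u" if "s \<le> u" for s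
      unfolding J_def using losses_before_mono[OF that] losses_before_finite[OF r]
      by (intro enn2real_mono) auto
    then show "l0 - l + \<Lambda> * J s \<le> l0 - l + \<Lambda> * J u" if "s \<le> u" for s
      using that \<open>0 \<le> \<Lambda>\<close> by (simp add: mult_left_mono)
    show "0 \<le> l0 - l + \<Lambda> * J 0" using \<open>0 \<le> \<Lambda>\<close> \<open>l \<le> l0\<close> by (simp add: J_def)
  qed (use u \<open>0 \<le> \<beta>\<close> in auto)
  show "left_lim x t = x t" by (rule left[OF \<open>0 \<le> t\<close>])
  show "l \<le> x t" using ynn[OF \<open>0 \<le> t\<close>] by (simp add: y_def)
  have "0 \<le> integral {0..t} y" using I(2)[OF \<open>0 \<le> t\<close>] ynn by (intro integral_nonneg) auto
  then show "x t \<le> l0 + \<Lambda> * enn2real (losses_before \<tau> Z t \<omega>)"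
    using x[OF \<open>0 \<le> t\<close>] I(1)[OF \<open>0 \<le> t\<close>] \<open>0 \<le> \<beta>\<close> by (simp add: J_def)
qed

section \<open>The compensator formula of a marked Hawkes process\<close>

locale hawkes_losses = usual_filtered_prob_space Q F
  for Q :: "'a measure" and F :: "real \<Rightarrow> 'a measure" +
  fixes \<Theta> :: "real measure" and \<tau> :: "nat \<Rightarrow> 'a \<Rightarrow> ennreal" and Z :: "nat \<Rightarrow> 'a \<Rightarrow> real"
    and lam :: "real \<Rightarrow> 'a \<Rightarrow> real" and \<beta> \<Lambda> l0 l :: real
  assumes sets_Theta: "sets \<Theta> = sets Rplus"
    and moments: "(\<integral>\<^sup>+z. ennreal (1 + z + z\<^sup>2) \<partial>\<Theta>) < \<infinity>"
    and Lambda_nonneg: "0 \<le> \<Lambda>" and beta_nonneg: "0 \<le> \<beta>" and l_nonneg: "0 \<le> l" and l_le: "l \<le> l0"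
    and hawkes: "marked_hawkes_process Q F \<Theta> (\<lambda>z. \<Lambda> * z) \<beta> l0 l \<tau> Z lam"
begin

abbreviation "\<nu> \<equiv> counting_random_measure \<tau> Z"
abbreviation "L \<equiv> losses_before \<tau> Z"

lemma space_Theta: "space \<Theta> = {0..}"
  using sets_eq_imp_space_eq[OF sets_Theta] by (simp add: space_restrict_space)

lemma measurable_Theta: "borel_measurable \<Theta> = borel_measurable Rplus"
  by (rule measurable_cong_sets[OF sets_Theta refl])

lemma id_measurable_Theta[measurable]: "(\<lambda>z. z) \<in> borel_measurable \<Theta>"
  unfolding measurable_Theta by (rule measurable_restrict_space1) simp

lemma moment_bound:
  assumes "\<And>z. 0 \<le> z \<Longrightarrow> g z \<le> ennreal (1 + z + z\<^sup>2)"
  shows "(\<integral>\<^sup>+z. g z \<partial>\<Theta>) < \<infinity>"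
proof -
  have "(\<integral>\<^sup>+z. g z \<partial>\<Theta>) \<le> (\<integral>\<^sup>+z. ennreal (1 + z + z\<^sup>2) \<partial>\<Theta>)"
    by (rule nn_integral_mono) (use assms in \<open>simp add: space_Theta\<close>)
  then show ?thesis using moments by (rule order_le_less_trans)
qed

lemma finite_Theta: "finite_measure \<Theta>"
proof (rule finite_measureI)
  have "(\<integral>\<^sup>+z. 1 \<partial>\<Theta>) < \<infinity>"
    by (rule moment_bound) (simp add: ennreal_1[symmetric] ennreal_leI del: ennreal_1 ennreal_plus)
  then show "emeasure \<Theta> (space \<Theta>) \<noteq> \<infinity>" by simp
qed

lemma first_moment: "(\<integral>\<^sup>+z. ennreal z \<partial>\<Theta>) < \<infinity>"
  by (rule moment_bound) (intro ennreal_leI, simp)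

lemma second_moment: "(\<integral>\<^sup>+z. (ennreal z)\<^sup>2 \<partial>\<Theta>) < \<infinity>"
  by (rule moment_bound) (simp add: ennreal_power ennreal_leI del: ennreal_plus)

lemma integrable_Theta_id: "integrable \<Theta> (\<lambda>z. z)"
proof (rule integrableI_nonneg)
  show "AE z in \<Theta>. 0 \<le> z" by (rule AE_I2) (simp add: space_Theta)
qed (use first_moment in simp_all)

lemma integrable_Theta_square: "integrable \<Theta> (\<lambda>z. z\<^sup>2)"
proof (rule integrableI_nonneg)
  have "(\<integral>\<^sup>+z. ennreal (z\<^sup>2) \<partial>\<Theta>) = (\<integral>\<^sup>+z. (ennreal z)\<^sup>2 \<partial>\<Theta>)"
    by (rule nn_integral_cong) (simp add: space_Theta ennreal_power)
  then show "(\<integral>\<^sup>+z. ennreal (z\<^sup>2) \<partial>\<Theta>) < \<infinity>" using second_moment by simp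
qed simp_all

lemma marked_point_process: "marked_point_process Q F \<tau> Z"
  using hawkes by (simp add: marked_hawkes_process_def)

lemma tau_measurable[measurable]: "\<tau> i \<in> borel_measurable Q"
  using marked_point_process by (simp add: marked_point_process_def)

lemma Z_measurable_Rplus: "Z i \<in> measurable Q Rplus"
  using marked_point_process by (simp add: marked_point_process_def)

lemma Z_measurable[measurable]: "Z i \<in> borel_measurable Q"
  using Z_measurable_Rplus by (simp add: measurable_restrict_space2_iff)

lemma Z_nonneg: "\<omega> \<in> space Q \<Longrightarrow> 0 \<le> Z i \<omega>"
  using measurable_space[OF Z_measurable_Rplus] by (simp add: space_restrict_space)

lemma AE_regular: "AE \<omega> in Q. regular_path \<tau> Z \<omega>"
proof -
  have "AE \<omega> in Q. 0 < \<tau> 0 \<omega> \<and>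
       (\<forall>i. \<tau> i \<omega> \<le> \<tau> (Suc i) \<omega> \<and> (\<tau> i \<omega> < \<infinity> \<longrightarrow> \<tau> i \<omega> < \<tau> (Suc i) \<omega>)) \<and>
       (\<lambda>i. \<tau> i \<omega>) \<longlonglongrightarrow> \<infinity>"
    using marked_point_process unfolding marked_point_process_def by blast
  moreover have "AE \<omega> in Q. \<forall>i. 0 \<le> Z i \<omega>" using Z_nonneg by (intro AE_I2) simp
  ultimately show ?thesis by eventually_elim (simp add: regular_path_def)
qed

lemma AE_intensity:
  "AE \<omega> in Q. (\<lambda>s. ennreal (left_lim (\<lambda>u. lam u \<omega>) s)) \<in> borel_measurable (restrict_space lborel {0..}) \<and>
    (\<forall>t\<ge>0. left_lim (\<lambda>u. lam u \<omega>) t = lam t \<omega> \<and> l \<le> lam t \<omega>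
      \<and> lam t \<omega> \<le> l0 + \<Lambda> * enn2real (L t \<omega>))"
proof -
  have "AE \<omega> in Q. \<forall>t\<ge>0. set_integrable lborel {0..t} (left_lim (\<lambda>u. lam u \<omega>)) \<and>
       lam t \<omega> = l0 + \<beta> * (LBINT s:{0..t}. l - left_lim (\<lambda>u. lam u \<omega>) s)
                 + (LINT (s, z):{0..<t} \<times> {0..}|\<nu> \<omega>. \<Lambda> * z)"
    using hawkes unfolding marked_hawkes_process_def hawkes_intensity_def by blast
  with AE_regular show ?thesis
  proof eventually_elim
    case (elim \<omega>)
    let ?x = "left_lim (\<lambda>u. lam u \<omega>)"
    have int: "set_integrable lborel {0..t} ?x" if "0 \<le> t" for t using elim(2) that by blast
    have "(\<lambda>s. indicator {0..real n} s * ?x s) \<in> borel_measurable lborel" for n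
      using borel_measurable_integrable[OF int[of "real n", unfolded set_integrable_def]] by simp
    moreover have "(\<lambda>n. indicator {0..real n} s * ?x s) \<longlonglongrightarrow> indicator {0..} s * ?x s" for s
    proof (rule tendsto_eventually)
      obtain m :: nat where "s \<le> real m" using real_arch_simple by blast
      then show "eventually (\<lambda>n. indicator {0..real n} s * ?x s = indicator {0..} s * ?x s) sequentially"
        by (intro eventually_sequentiallyI[of m]) (auto simp: indicator_def)
    qed
    ultimately have "(\<lambda>s. indicator {0..} s * ?x s) \<in> borel_measurable lborel"
      by (rule borel_measurable_LIMSEQ_real[rotated])
    then have "(\<lambda>s. ennreal (?x s)) \<in> borel_measurable (restrict_space lborel {0..})"
      by (intro measurable_compose[OF _ measurable_ennreal])
        (simp add: borel_measurable_restrict_space_iff)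
    moreover have "?x t = lam t \<omega> \<and> l \<le> lam t \<omega> \<and> lam t \<omega> \<le> l0 + \<Lambda> * enn2real (L t \<omega>)" if "0 \<le> t" for t
      using hawkes_path_bounds[OF elim(1) beta_nonneg Lambda_nonneg l_le, of "\<lambda>u. lam u \<omega>" t] elim(2) that
      by blast
    ultimately show ?case by blast
  qed
qed

text \<open>The defining property of the compensator, with both sides written out: a sum over the losses on the
  left, the intensity itself instead of its left limits on the right.\<close>

lemma compensator_formula:
  fixes H :: "('a \<times> real) \<times> real \<Rightarrow> ennreal"
  assumes H[measurable]: "H \<in> borel_measurable (predictable_sigma Q F \<Otimes>\<^sub>M Rplus)"
  shows "(\<integral>\<^sup>+\<omega>. (\<Sum>i. if \<tau> i \<omega> < \<infinity> then H ((\<omega>, enn2real (\<tau> i \<omega>)), Z i \<omega>) else 0) \<partial>Q)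
    = (\<integral>\<^sup>+\<omega>. (\<integral>\<^sup>+s\<in>{0..}. ennreal (lam s \<omega>) * (\<integral>\<^sup>+z. H ((\<omega>, s), z) \<partial>\<Theta>) \<partial>lborel) \<partial>Q)"
proof -
  interpret Th: finite_measure \<Theta> by (rule finite_Theta)
  let ?R = "restrict_space lborel {0::real..}"
  have path_section: "(\<lambda>(s, z). H ((\<omega>, s), z)) \<in> borel_measurable (Rplus \<Otimes>\<^sub>M Rplus)" if "\<omega> \<in> space Q" for \<omega>
  proof -
    note [measurable] = predictable_section[OF that]
    show ?thesis by measurable
  qed
  have sR: "sets (?R \<Otimes>\<^sub>M \<Theta>) = sets (Rplus \<Otimes>\<^sub>M Rplus)"
    by (intro sets_pair_measure_cong sets_Theta sets_restrict_space_cong) simp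
  have "(\<integral>\<^sup>+\<omega>. (\<integral>\<^sup>+(s, z). H ((\<omega>, s), z) \<partial>\<nu> \<omega>) \<partial>Q)
      = (\<integral>\<^sup>+\<omega>. (\<integral>\<^sup>+(s, z). H ((\<omega>, s), z) \<partial>intensity_measure \<Theta> lam \<omega>) \<partial>Q)"
    using hawkes H unfolding marked_hawkes_process_def is_compensator_def by blast
  moreover have "(\<integral>\<^sup>+\<omega>. (\<integral>\<^sup>+(s, z). H ((\<omega>, s), z) \<partial>\<nu> \<omega>) \<partial>Q)
      = (\<integral>\<^sup>+\<omega>. (\<Sum>i. if \<tau> i \<omega> < \<infinity> then H ((\<omega>, enn2real (\<tau> i \<omega>)), Z i \<omega>) else 0) \<partial>Q)"
    by (rule nn_integral_cong, subst nn_integral_counting_random_measure)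
      (auto simp: Z_nonneg path_section)
  moreover have "(\<integral>\<^sup>+\<omega>. (\<integral>\<^sup>+(s, z). H ((\<omega>, s), z) \<partial>intensity_measure \<Theta> lam \<omega>) \<partial>Q)
      = (\<integral>\<^sup>+\<omega>. (\<integral>\<^sup>+s\<in>{0..}. ennreal (lam s \<omega>) * (\<integral>\<^sup>+z. H ((\<omega>, s), z) \<partial>\<Theta>) \<partial>lborel) \<partial>Q)"
  proof (rule nn_integral_cong_AE)
    show "AE \<omega> in Q. (\<integral>\<^sup>+(s, z). H ((\<omega>, s), z) \<partial>intensity_measure \<Theta> lam \<omega>)
        = (\<integral>\<^sup>+s\<in>{0..}. ennreal (lam s \<omega>) * (\<integral>\<^sup>+z. H ((\<omega>, s), z) \<partial>\<Theta>) \<partial>lborel)"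
      using AE_intensity AE_space
    proof eventually_elim
      case (elim \<omega>)
      let ?x = "\<lambda>s. ennreal (left_lim (\<lambda>u. lam u \<omega>) s)"
      have x[measurable]: "?x \<in> borel_measurable ?R" using elim(1) by blast
      have h[measurable]: "(\<lambda>(s, z). H ((\<omega>, s), z)) \<in> borel_measurable (?R \<Otimes>\<^sub>M \<Theta>)"
        using path_section[OF elim(2)] by (simp add: measurable_cong_sets[OF sR refl])
      have "(\<integral>\<^sup>+(s, z). H ((\<omega>, s), z) \<partial>intensity_measure \<Theta> lam \<omega>)
          = (\<integral>\<^sup>+p. ?x (fst p) * (case p of (s, z) \<Rightarrow> H ((\<omega>, s), z)) \<partial>(?R \<Otimes>\<^sub>M \<Theta>))"
        unfolding intensity_measure_def
        by (subst nn_integral_density) (auto intro!: nn_integral_cong)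
      also have "\<dots> = (\<integral>\<^sup>+s. (\<integral>\<^sup>+z. ?x s * H ((\<omega>, s), z) \<partial>\<Theta>) \<partial>?R)"
        by (subst Th.nn_integral_fst[symmetric]) simp_all
      also have "\<dots> = (\<integral>\<^sup>+s. ennreal (lam s \<omega>) * (\<integral>\<^sup>+z. H ((\<omega>, s), z) \<partial>\<Theta>) \<partial>?R)"
      proof (rule nn_integral_cong)
        fix s assume s: "s \<in> space ?R"
        then have "?x s = ennreal (lam s \<omega>)" using elim(1) by (simp add: space_restrict_space)
        moreover have "(\<lambda>z. H ((\<omega>, s), z)) \<in> borel_measurable \<Theta>"
          using measurable_compose[OF measurable_Pair1'[OF s] h] by simp
        ultimately show "(\<integral>\<^sup>+z. ?x s * H ((\<omega>, s), z) \<partial>\<Theta>) = ennreal (lam s \<omega>) * (\<integral>\<^sup>+z. H ((\<omega>, s), z) \<partial>\<Theta>)"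
          by (simp add: nn_integral_cmult)
      qed
      also have "\<dots> = (\<integral>\<^sup>+s\<in>{0..}. ennreal (lam s \<omega>) * (\<integral>\<^sup>+z. H ((\<omega>, s), z) \<partial>\<Theta>) \<partial>lborel)"
        by (rule nn_integral_restrict_space) simp
      finally show ?case .
    qed
  qed
  ultimately show ?thesis by simp
qed

end

section \<open>The total loss is square integrable\<close>

text \<open>The pathwise identity that turns the squared loss into a sum over the losses, to which the
  compensator formula applies.\<close>

lemma square_of_sum_telescope:
  fixes a :: "nat \<Rightarrow> ennreal"
  shows "(\<Sum>i<n. a i)\<^sup>2 = (\<Sum>i<n. 2 * (\<Sum>j<i. a j) * a i + (a i)\<^sup>2)"
  by (induction n) (simp_all add: power2_sum algebra_simps)

lemma quadratic_growth:
  fixes x m n a b :: ennreal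
  shows "(2 * x * m + n) * (a + b * x) \<le> (2 * (2 * m + n) * (a + b)) * (1 + x\<^sup>2)"
proof -
  have x: "x \<le> 1 + x" "1 \<le> 1 + x" by simp_all
  have sq: "(1 + x)\<^sup>2 \<le> 2 * (1 + x\<^sup>2)"
  proof (cases x)
    case (real r)
    have "0 \<le> (1 - r)\<^sup>2" by simp
    then have "(1 + r)\<^sup>2 \<le> 2 * (1 + r\<^sup>2)" by (simp add: power2_sum power2_diff)
    then have "ennreal ((1 + r)\<^sup>2) \<le> ennreal (2 * (1 + r\<^sup>2))" by (rule ennreal_leI)
    moreover have "(1 + x)\<^sup>2 = ennreal ((1 + r)\<^sup>2)"
      using real by (simp add: ennreal_power[symmetric] ennreal_plus)
    moreover have "2 * (1 + x\<^sup>2) = ennreal (2 * (1 + r\<^sup>2))"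
      using real by (simp add: ennreal_mult ennreal_power[symmetric] ennreal_plus)
    ultimately show ?thesis by simp
  next
    case top
    then show ?thesis by (simp add: power2_eq_square ennreal_mult_top)
  qed
  have "2 * x * m + n \<le> (2 * m + n) * (1 + x)"
  proof -
    have "2 * x * m + n \<le> 2 * (1 + x) * m + n * (1 + x)"
      using x mult_left_mono[OF x(2), of n] by (intro add_mono mult_mono) simp_all
    then show ?thesis by (simp add: algebra_simps)
  qed
  moreover have "a + b * x \<le> (a + b) * (1 + x)"
  proof -
    have "a + b * x \<le> a * (1 + x) + b * (1 + x)"
      using x(1) mult_left_mono[OF x(2), of a] by (intro add_mono mult_left_mono) simp_all
    then show ?thesis by (simp add: algebra_simps)
  qed
  ultimately have "(2 * x * m + n) * (a + b * x) \<le> ((2 * m + n) * (1 + x)) * ((a + b) * (1 + x))"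
    by (rule mult_mono) simp_all
  also have "\<dots> = (2 * m + n) * (a + b) * (1 + x)\<^sup>2"
    by (simp add: power2_eq_square ac_simps)
  also have "\<dots> \<le> (2 * m + n) * (a + b) * (2 * (1 + x\<^sup>2))"
    by (rule mult_left_mono[OF sq]) simp
  finally show ?thesis by (simp only: ac_simps)
qed

context hawkes_losses
begin

lemma adapted:
  assumes "0 \<le> t" and "B \<in> sets borel"
  shows "{\<omega> \<in> space Q. \<tau> i \<omega> \<le> ennreal t \<and> Z i \<omega> \<in> B} \<in> sets (F t)"
  using marked_point_process assms by (simp add: marked_point_process_def)

text \<open>The event is determined by a rational time \<open>q\<close> between the loss and the present, and what is known at
  time \<open>q\<close> may be used after \<open>q\<close>.\<close>

lemma predictable_loss:
  assumes B: "B \<in> sets borel"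
  shows "{w \<in> space (predictable_sigma Q F). \<tau> i (fst w) < ennreal (snd w) \<and> Z i (fst w) \<in> B}
    \<in> sets (predictable_sigma Q F)" (is "?A \<in> _")
proof -
  let ?C = "\<lambda>q. {\<omega> \<in> space Q. \<tau> i \<omega> \<le> ennreal q \<and> Z i \<omega> \<in> B} \<times> {q<..}"
  have "?A = (\<Union>q\<in>\<rat> \<inter> {0..}. ?C q)"
  proof (intro equalityI subsetI)
    fix w assume w: "w \<in> ?A"
    obtain \<omega> s where ws: "w = (\<omega>, s)" by fastforce
    with w have *: "\<omega> \<in> space Q" "0 \<le> s" "\<tau> i \<omega> < ennreal s" "Z i \<omega> \<in> B"
      by (auto simp: space_predictable)
    then have fin: "\<tau> i \<omega> < \<infinity>" by (simp add: order_less_trans)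
    then have "enn2real (\<tau> i \<omega>) < s" using * by (simp add: enn2real_less_iff)
    then obtain q where q: "q \<in> \<rat>" "enn2real (\<tau> i \<omega>) < q" "q < s" using Rats_dense_in_real by blast
    have "0 \<le> q" using q(2) enn2real_nonneg[of "\<tau> i \<omega>"] by linarith
    moreover have "\<tau> i \<omega> \<le> ennreal q"
      using q(2) enn2real_less_iff[OF fin, of q] by simp
    ultimately show "w \<in> (\<Union>q\<in>\<rat> \<inter> {0..}. ?C q)" using * q ws by auto
  next
    fix w assume "w \<in> (\<Union>q\<in>\<rat> \<inter> {0..}. ?C q)"
    then obtain q where q: "0 \<le> q" "fst w \<in> space Q" "\<tau> i (fst w) \<le> ennreal q" "Z i (fst w) \<in> B" "q < snd w"
      by auto
    then have "\<tau> i (fst w) < ennreal (snd w)"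
      by (meson ennreal_lessI order_le_less_trans)
    then show "w \<in> ?A" using q by (auto simp: space_predictable mem_Times_iff)
  qed
  also have "\<dots> \<in> sets (predictable_sigma Q F)"
    by (intro sets.countable_UN'' countable_Int1 countable_rat sets_predictable_after adapted B) auto
  finally show ?thesis .
qed

lemma predictable_losses_before:
  "(\<lambda>w. L (snd w) (fst w)) \<in> borel_measurable (predictable_sigma Q F)"
proof -
  have "(\<lambda>w. if \<tau> i (fst w) < ennreal (snd w) then ennreal (Z i (fst w)) else 0)
      \<in> borel_measurable (predictable_sigma Q F)" for i
  proof (rule borel_measurableI_greater)
    fix a :: ennreal
    have "{w \<in> space (predictable_sigma Q F). a < (if \<tau> i (fst w) < ennreal (snd w) then ennreal (Z i (fst w)) else 0)}
      = {w \<in> space (predictable_sigma Q F). \<tau> i (fst w) < ennreal (snd w) \<and> Z i (fst w) \<in> {x. a < ennreal x}}"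
      by auto
    also have "\<dots> \<in> sets (predictable_sigma Q F)" by (rule predictable_loss) measurable
    finally show "{w \<in> space (predictable_sigma Q F). a < (if \<tau> i (fst w) < ennreal (snd w) then ennreal (Z i (fst w)) else 0)}
      \<in> sets (predictable_sigma Q F)" .
  qed
  then show ?thesis unfolding losses_before_def by (rule borel_measurable_suminf_order)
qed

text \<open>The increment of the squared running loss at a loss of size \<open>z\<close> at time \<open>s\<close>, counted up to time \<open>t\<close> and
  as long as the running loss does not exceed \<open>K\<close>.\<close>

definition square_increment :: "nat \<Rightarrow> real \<Rightarrow> ('a \<times> real) \<times> real \<Rightarrow> ennreal" where
  "square_increment K t = (\<lambda>((\<omega>, s), z).
     if s \<le> t \<and> L s \<omega> \<le> of_nat K then 2 * L s \<omega> * ennreal z + (ennreal z)\<^sup>2 else 0)"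

text \<open>On regular paths this is the square of the running loss, stopped at the first loss
  that takes it above \<open>K\<close> (that loss included).\<close>

definition stopped_square :: "nat \<Rightarrow> real \<Rightarrow> 'a \<Rightarrow> ennreal" where
  "stopped_square K t \<omega> =
     (\<Sum>i. if \<tau> i \<omega> < \<infinity> then square_increment K t ((\<omega>, enn2real (\<tau> i \<omega>)), Z i \<omega>) else 0)"

lemma square_increment_measurable:
  "square_increment K t \<in> borel_measurable (predictable_sigma Q F \<Otimes>\<^sub>M Rplus)"
proof -
  note [measurable] = measurable_compose[OF measurable_fst predictable_losses_before]
    measurable_compose[OF measurable_fst predictable_time] borel_measurable_snd_Rplus
  have "(\<lambda>p. if snd (fst p) \<le> t \<and> L (snd (fst p)) (fst (fst p)) \<le> of_nat K
      then 2 * L (snd (fst p)) (fst (fst p)) * ennreal (snd p) + (ennreal (snd p))\<^sup>2 else 0)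
    \<in> borel_measurable (predictable_sigma Q F \<Otimes>\<^sub>M Rplus)" by measurable
  then show ?thesis by (simp add: square_increment_def case_prod_unfold)
qed

lemma losses_before_measurable[measurable]:
  assumes [measurable]: "f \<in> borel_measurable Q"
  shows "(\<lambda>\<omega>. L (f \<omega>) \<omega>) \<in> borel_measurable Q"
  unfolding losses_before_def by measurable

lemma stopped_square_measurable[measurable]:
  "(\<lambda>(t, \<omega>). stopped_square K t \<omega>) \<in> borel_measurable (lborel \<Otimes>\<^sub>M Q)"
  "stopped_square K t \<in> borel_measurable Q"
proof -
  show *: "(\<lambda>(t, \<omega>). stopped_square K t \<omega>) \<in> borel_measurable (lborel \<Otimes>\<^sub>M Q)"
  proof -
    define V where "V i \<omega> = L (enn2real (\<tau> i \<omega>)) \<omega>" for i \<omega>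
    have [measurable]: "V i \<in> borel_measurable Q" for i unfolding V_def by measurable
    have "stopped_square K t \<omega> = (\<Sum>i. if \<tau> i \<omega> < \<infinity> \<and> enn2real (\<tau> i \<omega>) \<le> t \<and> V i \<omega> \<le> of_nat K
        then 2 * V i \<omega> * ennreal (Z i \<omega>) + (ennreal (Z i \<omega>))\<^sup>2 else 0)" for t \<omega>
      unfolding stopped_square_def square_increment_def V_def by (intro suminf_cong) auto
    then show ?thesis by simp
  qed
  show "stopped_square K t \<in> borel_measurable Q"
    using measurable_compose[OF measurable_Pair1' *, of t] by simp
qed

lemma square_le_stopped_square:
  assumes r: "regular_path \<tau> Z \<omega>" and K: "L t \<omega> \<le> of_nat K" and "0 \<le> t"
  shows "(L t \<omega>)\<^sup>2 \<le> stopped_square K t \<omega>"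
proof -
  have Z0: "0 \<le> Z i \<omega>" for i using r by (simp add: regular_path_def)
  obtain n where n: "\<And>i. \<tau> i \<omega> < ennreal t \<longleftrightarrow> i < n"
    using regular_path_before[OF r, of t] by blast
  have Lt: "L t \<omega> = (\<Sum>i<n. ennreal (Z i \<omega>))"
    using losses_before_eq_sum[of \<tau> \<omega> t n Z] n Z0 by (simp add: sum_ennreal)
  have incr: "square_increment K t ((\<omega>, enn2real (\<tau> i \<omega>)), Z i \<omega>)
      = 2 * (\<Sum>j<i. ennreal (Z j \<omega>)) * ennreal (Z i \<omega>) + (ennreal (Z i \<omega>))\<^sup>2"
    and fin: "\<tau> i \<omega> < \<infinity>" if "i < n" for i
  proof -
    have i: "\<tau> i \<omega> < ennreal t" using n that by simp
    then show fin: "\<tau> i \<omega> < \<infinity>" by (simp add: order_less_trans)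
    then have e: "ennreal (enn2real (\<tau> i \<omega>)) = \<tau> i \<omega>" by simp
    have le: "enn2real (\<tau> i \<omega>) \<le> t" using i fin by (simp add: enn2real_less_iff less_imp_le)
    have "L (enn2real (\<tau> i \<omega>)) \<omega> = (\<Sum>j<i. ennreal (Z j \<omega>))"
      using losses_before_eq_sum[of \<tau> \<omega> "enn2real (\<tau> i \<omega>)" i Z] regular_path_strict[OF r fin] Z0
      unfolding e by (simp add: sum_ennreal)
    moreover have "L (enn2real (\<tau> i \<omega>)) \<omega> \<le> of_nat K"
      using losses_before_mono[OF le, of \<tau> Z \<omega>] K by (rule order_trans)
    ultimately show "square_increment K t ((\<omega>, enn2real (\<tau> i \<omega>)), Z i \<omega>)
      = 2 * (\<Sum>j<i. ennreal (Z j \<omega>)) * ennreal (Z i \<omega>) + (ennreal (Z i \<omega>))\<^sup>2"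
      using le by (simp add: square_increment_def)
  qed
  have "(L t \<omega>)\<^sup>2 = (\<Sum>i<n. 2 * (\<Sum>j<i. ennreal (Z j \<omega>)) * ennreal (Z i \<omega>) + (ennreal (Z i \<omega>))\<^sup>2)"
    unfolding Lt by (rule square_of_sum_telescope)
  also have "\<dots> = (\<Sum>i<n. if \<tau> i \<omega> < \<infinity> then square_increment K t ((\<omega>, enn2real (\<tau> i \<omega>)), Z i \<omega>) else 0)"
    by (rule sum.cong) (use incr fin in auto)
  also have "\<dots> \<le> stopped_square K t \<omega>"
    unfolding stopped_square_def by (rule sum_le_suminf) auto
  finally show ?thesis .
qed

lemma nn_integral_square_increment:
  "(\<integral>\<^sup>+z. square_increment K t ((\<omega>, s), z) \<partial>\<Theta>)
    = (if s \<le> t \<and> L s \<omega> \<le> of_nat K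
       then 2 * L s \<omega> * (\<integral>\<^sup>+z. ennreal z \<partial>\<Theta>) + (\<integral>\<^sup>+z. (ennreal z)\<^sup>2 \<partial>\<Theta>) else 0)"
proof (cases "s \<le> t \<and> L s \<omega> \<le> of_nat K")
  case True
  then show ?thesis by (simp add: square_increment_def nn_integral_add nn_integral_cmult)
next
  case False
  then have "square_increment K t ((\<omega>, s), z) = 0" for z by (auto simp: square_increment_def)
  then show ?thesis unfolding if_not_P[OF False] by simp
qed

text \<open>The increments are affine in the running loss \<open>L\<close> and the intensity is at most affine in \<open>L\<close>,
  so the drift grows at most like \<open>1 + L\<^sup>2\<close>. The first two moments of \<open>\<Theta>\<close> enter the constant,
  which depends neither on \<open>K\<close> nor on \<open>t\<close>.\<close>

lemma stopped_square_drift: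
  obtains c where "0 < c" and "\<And>K t. AE \<omega> in Q. \<forall>s\<ge>0.
      ennreal (lam s \<omega>) * (\<integral>\<^sup>+z. square_increment K t ((\<omega>, s), z) \<partial>\<Theta>)
      \<le> ennreal c * (1 + (if L s \<omega> \<le> of_nat K then (L s \<omega>)\<^sup>2 else 0)) * indicator {..t} s"
proof -
  let ?m = "\<integral>\<^sup>+z. ennreal z \<partial>\<Theta>" and ?n = "\<integral>\<^sup>+z. (ennreal z)\<^sup>2 \<partial>\<Theta>"
  define d where "d = 2 * (2 * ?m + ?n) * (ennreal l0 + ennreal \<Lambda>)"
  have "d < \<infinity>" using first_moment second_moment by (simp add: d_def ennreal_mult_less_top)
  then obtain d' where d': "d = ennreal d'" "0 \<le> d'"
    by (metis ennreal_cases infinity_ennreal_def less_irrefl)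
  have dc: "d \<le> ennreal (d' + 1)" unfolding d' by (rule ennreal_leI) simp
  show ?thesis
  proof (rule that[of "d' + 1"])
    show "0 < d' + 1" using d' by simp
    fix K t
    show "AE \<omega> in Q. \<forall>s\<ge>0.
      ennreal (lam s \<omega>) * (\<integral>\<^sup>+z. square_increment K t ((\<omega>, s), z) \<partial>\<Theta>)
      \<le> ennreal (d' + 1) * (1 + (if L s \<omega> \<le> of_nat K then (L s \<omega>)\<^sup>2 else 0)) * indicator {..t} s"
      using AE_intensity AE_regular
    proof eventually_elim
      case (elim \<omega>)
      show ?case
      proof (intro allI impI)
        fix s :: real assume s: "0 \<le> s"
        have Ls: "ennreal (enn2real (L s \<omega>)) = L s \<omega>"
          using losses_before_finite[OF elim(2), of s] by simp
        have "ennreal (lam s \<omega>) \<le> ennreal (l0 + \<Lambda> * enn2real (L s \<omega>))"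
          using elim(1) s by (intro ennreal_leI) blast
        also have "\<dots> = ennreal l0 + ennreal \<Lambda> * L s \<omega>"
          using l_nonneg l_le Lambda_nonneg Ls by (simp add: ennreal_plus ennreal_mult)
        finally have lam: "ennreal (lam s \<omega>) \<le> ennreal l0 + ennreal \<Lambda> * L s \<omega>" .
        have "(2 * L s \<omega> * ?m + ?n) * ennreal (lam s \<omega>)
            \<le> (2 * L s \<omega> * ?m + ?n) * (ennreal l0 + ennreal \<Lambda> * L s \<omega>)"
          by (rule mult_left_mono[OF lam]) simp
        also have "\<dots> \<le> d * (1 + (L s \<omega>)\<^sup>2)" unfolding d_def by (rule quadratic_growth)
        also have "\<dots> \<le> ennreal (d' + 1) * (1 + (L s \<omega>)\<^sup>2)" by (rule mult_right_mono[OF dc]) simp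
        finally show "ennreal (lam s \<omega>) * (\<integral>\<^sup>+z. square_increment K t ((\<omega>, s), z) \<partial>\<Theta>)
          \<le> ennreal (d' + 1) * (1 + (if L s \<omega> \<le> of_nat K then (L s \<omega>)\<^sup>2 else 0)) * indicator {..t} s"
          by (simp add: nn_integral_square_increment mult.commute[of "ennreal (lam s \<omega>)"])
      qed
    qed
  qed
qed

text \<open>Gronwall's inequality for \<open>v K t\<close>, the expectation of the stopped square. The drift is bounded
  once by the stopped square itself, which gives the integral inequality, and once by a constant
  depending on \<open>K\<close>, which gives the finiteness that Gronwall's inequality requires.\<close>

proposition losses_second_moment:
  assumes T: "0 \<le> T"
  shows "(\<integral>\<^sup>+\<omega>. (L T \<omega>)\<^sup>2 \<partial>Q) < \<infinity>"
proof -
  obtain c where c: "0 < c" and drift: "\<And>K t. AE \<omega> in Q. \<forall>s\<ge>0.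
      ennreal (lam s \<omega>) * (\<integral>\<^sup>+z. square_increment K t ((\<omega>, s), z) \<partial>\<Theta>)
      \<le> ennreal c * (1 + (if L s \<omega> \<le> of_nat K then (L s \<omega>)\<^sup>2 else 0)) * indicator {..t} s"
    using stopped_square_drift by blast
  define v where "v K t = (\<integral>\<^sup>+\<omega>. stopped_square K t \<omega> \<partial>Q)" for K t
  have v_eq: "v K t = (\<integral>\<^sup>+\<omega>. (\<integral>\<^sup>+s\<in>{0..}. ennreal (lam s \<omega>)
      * (\<integral>\<^sup>+z. square_increment K t ((\<omega>, s), z) \<partial>\<Theta>) \<partial>lborel) \<partial>Q)" for K t
    unfolding v_def stopped_square_def by (rule compensator_formula[OF square_increment_measurable])
  interpret Qlb: pair_sigma_finite Q lborel ..
  \<comment> \<open>Where \<open>L s \<le> K\<close>, the square of \<open>L s\<close> is at most the stopped square at time \<open>s\<close>.\<close>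
  have v_le: "v K t \<le> (\<integral>\<^sup>+s\<in>{0..t}. ennreal c * (1 + v K s) \<partial>lborel)" for K t
  proof -
    have "v K t \<le> (\<integral>\<^sup>+\<omega>. (\<integral>\<^sup>+s. ennreal c * (1 + stopped_square K s \<omega>) * indicator {0..t} s \<partial>lborel) \<partial>Q)"
      unfolding v_eq
    proof (rule nn_integral_mono_AE)
      show "AE \<omega> in Q. (\<integral>\<^sup>+s\<in>{0..}. ennreal (lam s \<omega>)
          * (\<integral>\<^sup>+z. square_increment K t ((\<omega>, s), z) \<partial>\<Theta>) \<partial>lborel)
        \<le> (\<integral>\<^sup>+s. ennreal c * (1 + stopped_square K s \<omega>) * indicator {0..t} s \<partial>lborel)"
        using drift[of K t] AE_regular
      proof eventually_elim
        case (elim \<omega>)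
        show ?case
        proof (rule nn_integral_mono)
          fix s :: real
          show "ennreal (lam s \<omega>) * (\<integral>\<^sup>+z. square_increment K t ((\<omega>, s), z) \<partial>\<Theta>) * indicator {0..} s
            \<le> ennreal c * (1 + stopped_square K s \<omega>) * indicator {0..t} s"
          proof (cases "0 \<le> s")
            case True
            have "(if L s \<omega> \<le> of_nat K then (L s \<omega>)\<^sup>2 else 0) \<le> stopped_square K s \<omega>"
              using square_le_stopped_square[OF elim(2) _ True] by simp
            then have "ennreal c * (1 + (if L s \<omega> \<le> of_nat K then (L s \<omega>)\<^sup>2 else 0)) * indicator {..t} s
                \<le> ennreal c * (1 + stopped_square K s \<omega>) * indicator {..t} s"
              by (intro mult_right_mono mult_left_mono add_left_mono) simp_all
            with elim(1) True
            have "ennreal (lam s \<omega>) * (\<integral>\<^sup>+z. square_increment K t ((\<omega>, s), z) \<partial>\<Theta>)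
                \<le> ennreal c * (1 + stopped_square K s \<omega>) * indicator {..t} s"
              by (blast intro: order_trans)
            then show ?thesis using True by (simp add: indicator_def)
          qed simp
        qed
      qed
    qed
    also have "\<dots> = (\<integral>\<^sup>+s. (\<integral>\<^sup>+\<omega>. ennreal c * (1 + stopped_square K s \<omega>) * indicator {0..t} s \<partial>Q) \<partial>lborel)"
      by (rule Qlb.Fubini'[symmetric]) measurable
    also have "\<dots> = (\<integral>\<^sup>+s\<in>{0..t}. ennreal c * (1 + v K s) \<partial>lborel)"
      by (rule nn_integral_cong)
        (simp add: nn_integral_multc nn_integral_cmult nn_integral_add emeasure_space_1 v_def)
    finally show ?thesis .
  qed
  have v_fin: "v K t \<le> ennreal c * (1 + (of_nat K)\<^sup>2) * ennreal T" if "0 \<le> t" "t \<le> T" for K t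
  proof -
    have "v K t \<le> (\<integral>\<^sup>+\<omega>. (\<integral>\<^sup>+s. ennreal c * (1 + (of_nat K)\<^sup>2) * indicator {0..t} s \<partial>lborel) \<partial>Q)"
      unfolding v_eq
    proof (rule nn_integral_mono_AE)
      show "AE \<omega> in Q. (\<integral>\<^sup>+s\<in>{0..}. ennreal (lam s \<omega>)
          * (\<integral>\<^sup>+z. square_increment K t ((\<omega>, s), z) \<partial>\<Theta>) \<partial>lborel)
        \<le> (\<integral>\<^sup>+s. ennreal c * (1 + (of_nat K)\<^sup>2) * indicator {0..t} s \<partial>lborel)"
        using drift[of K t]
      proof eventually_elim
        case (elim \<omega>)
        show ?case
        proof (rule nn_integral_mono)
          fix s :: real
          have "(if L s \<omega> \<le> of_nat K then (L s \<omega>)\<^sup>2 else 0) \<le> (of_nat K)\<^sup>2"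
            by (simp add: power_mono)
          then have "ennreal c * (1 + (if L s \<omega> \<le> of_nat K then (L s \<omega>)\<^sup>2 else 0)) * indicator {..t} s
              \<le> ennreal c * (1 + (of_nat K)\<^sup>2) * indicator {..t} s"
            by (intro mult_right_mono mult_left_mono add_left_mono) simp_all
          with elim have "0 \<le> s \<Longrightarrow>
              ennreal (lam s \<omega>) * (\<integral>\<^sup>+z. square_increment K t ((\<omega>, s), z) \<partial>\<Theta>)
              \<le> ennreal c * (1 + (of_nat K)\<^sup>2) * indicator {..t} s"
            by (blast intro: order_trans)
          then show "ennreal (lam s \<omega>) * (\<integral>\<^sup>+z. square_increment K t ((\<omega>, s), z) \<partial>\<Theta>) * indicator {0..} s
            \<le> ennreal c * (1 + (of_nat K)\<^sup>2) * indicator {0..t} s"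
            by (cases "0 \<le> s") (simp_all add: indicator_def)
        qed
      qed
    qed
    also have "\<dots> = ennreal c * (1 + (of_nat K)\<^sup>2) * ennreal t"
      using that by (simp add: nn_integral_cmult emeasure_space_1)
    also have "\<dots> \<le> ennreal c * (1 + (of_nat K)\<^sup>2) * ennreal T"
      using that by (intro mult_left_mono ennreal_leI) simp_all
    finally show ?thesis .
  qed
  have v_bound: "v K T \<le> ennreal (2 * exp (2 * c * T))" for K
  proof (rule gronwall_ennreal[OF c T v_le v_fin])
    have "ennreal c * (1 + (of_nat K)\<^sup>2) * ennreal T < top"
      by (simp add: ennreal_mult_less_top power_less_top_ennreal of_nat_less_top)
    then show "ennreal c * (1 + (of_nat K)\<^sup>2) * ennreal T < \<infinity>" by simp
  qed
  define g where "g K \<omega> = (if L T \<omega> \<le> of_nat K then (L T \<omega>)\<^sup>2 else 0)" for K :: nat and \<omega>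
  have gv: "(\<integral>\<^sup>+\<omega>. g K \<omega> \<partial>Q) \<le> ennreal (2 * exp (2 * c * T))" for K
  proof -
    have "(\<integral>\<^sup>+\<omega>. g K \<omega> \<partial>Q) \<le> v K T" unfolding v_def
      by (rule nn_integral_mono_AE)
        (use AE_regular in \<open>eventually_elim, auto simp: g_def square_le_stopped_square T\<close>)
    then show ?thesis using v_bound by (rule order_trans)
  qed
  have "(\<integral>\<^sup>+\<omega>. (L T \<omega>)\<^sup>2 \<partial>Q) = (\<integral>\<^sup>+\<omega>. (SUP K. g K \<omega>) \<partial>Q)"
  proof (rule nn_integral_cong_AE)
    show "AE \<omega> in Q. (L T \<omega>)\<^sup>2 = (SUP K. g K \<omega>)"
      using AE_regular
    proof eventually_elim
      case (elim \<omega>)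
      obtain K :: nat where "enn2real (L T \<omega>) \<le> real K" using real_arch_simple by blast
      then have K: "L T \<omega> \<le> of_nat K"
        using losses_before_finite[OF elim, of T] by (simp add: enn2real_le_iff ennreal_of_nat_eq_real_of_nat)
      show ?case
      proof (rule antisym)
        have "(L T \<omega>)\<^sup>2 = g K \<omega>" using K by (simp add: g_def)
        also have "\<dots> \<le> (SUP K. g K \<omega>)" by (rule SUP_upper) simp
        finally show "(L T \<omega>)\<^sup>2 \<le> (SUP K. g K \<omega>)" .
        show "(SUP K. g K \<omega>) \<le> (L T \<omega>)\<^sup>2" by (rule SUP_least) (simp add: g_def)
      qed
    qed
  qed
  also have "\<dots> = (SUP K. \<integral>\<^sup>+\<omega>. g K \<omega> \<partial>Q)"
  proof (rule nn_integral_monotone_convergence_SUP)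
    show "incseq g"
    proof (rule incseq_SucI, rule le_funI)
      fix K \<omega>
      show "g K \<omega> \<le> g (Suc K) \<omega>"
        using order_trans[of "L T \<omega>" "of_nat K" "of_nat (Suc K)"] of_nat_mono[of K "Suc K"]
        by (auto simp: g_def simp del: of_nat_Suc)
    qed
    show "g K \<in> borel_measurable Q" for K unfolding g_def by measurable
  qed
  also have "\<dots> \<le> ennreal (2 * exp (2 * c * T))" by (rule SUP_least) (rule gv)
  finally show ?thesis by (rule order_le_less_trans) simp
qed

end

section \<open>Claims as functions of the contract\<close>

context hawkes_losses
begin

text \<open>The expected number of losses with marks in a \<open>\<Theta>\<close>-null set vanishes, since the compensator
  gives no mass to such marks. Therefore modifications of a contract on \<open>\<Theta>\<close>-null sets change
  the wealth on a null set of paths at most.\<close>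

lemma AE_marks:
  assumes "AE z in \<Theta>. P z"
  shows "AE \<omega> in Q. \<forall>i. \<tau> i \<omega> < \<infinity> \<longrightarrow> P (Z i \<omega>)"
proof -
  obtain N where N: "{z \<in> space \<Theta>. \<not> P z} \<subseteq> N" "emeasure \<Theta> N = 0" "N \<in> sets \<Theta>"
    using assms by (rule AE_E)
  define H :: "('a \<times> real) \<times> real \<Rightarrow> ennreal" where "H p = indicator N (snd p)" for p
  have "N \<in> sets Rplus" using N(3) sets_Theta by simp
  then have H: "H \<in> borel_measurable (predictable_sigma Q F \<Otimes>\<^sub>M Rplus)"
    unfolding H_def by measurable
  have HN: "(\<integral>\<^sup>+z. H ((\<omega>, s), z) \<partial>\<Theta>) = 0" for \<omega> s
    using N by (simp add: H_def)
  have "(\<integral>\<^sup>+\<omega>. (\<Sum>i. if \<tau> i \<omega> < \<infinity> then H ((\<omega>, enn2real (\<tau> i \<omega>)), Z i \<omega>) else 0) \<partial>Q) = 0"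
    unfolding compensator_formula[OF H] HN by simp
  moreover have "(\<lambda>\<omega>. \<Sum>i. if \<tau> i \<omega> < \<infinity> then H ((\<omega>, enn2real (\<tau> i \<omega>)), Z i \<omega>) else 0) \<in> borel_measurable Q"
  proof -
    have [measurable]: "(\<lambda>\<omega>. indicator N (Z i \<omega>) :: ennreal) \<in> borel_measurable Q" for i
      using measurable_compose[OF Z_measurable_Rplus, of "indicator N :: real \<Rightarrow> ennreal" borel i]
        \<open>N \<in> sets Rplus\<close> by simp
    show ?thesis unfolding H_def snd_conv by measurable
  qed
  ultimately have "AE \<omega> in Q. (\<Sum>i. if \<tau> i \<omega> < \<infinity> then H ((\<omega>, enn2real (\<tau> i \<omega>)), Z i \<omega>) else 0) = 0"
    by (simp add: nn_integral_0_iff_AE)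
  with AE_space show ?thesis
  proof eventually_elim
    case (elim \<omega>)
    show ?case
    proof (intro allI impI)
      fix i assume i: "\<tau> i \<omega> < \<infinity>"
      have "(if \<tau> i \<omega> < \<infinity> then H ((\<omega>, enn2real (\<tau> i \<omega>)), Z i \<omega>) else 0) = 0"
        using elim(2) by (simp add: suminf_eq_zero_iff)
      then have "Z i \<omega> \<notin> N" using i by (auto simp: H_def indicator_def split: if_splits)
      then show "P (Z i \<omega>)" using N(1) Z_nonneg[OF elim(1)] by (auto simp: space_Theta)
    qed
  qed
qed

definition claims :: "real \<Rightarrow> (real \<Rightarrow> real) \<Rightarrow> 'a \<Rightarrow> real"
  where "claims T g \<omega> = (LINT (s, z):{0..T} \<times> {0..}|\<nu> \<omega>. g z)"

lemma claims_eq_sum: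
  assumes r: "regular_path \<tau> Z \<omega>" and g: "g \<in> borel_measurable \<Theta>" and "0 \<le> T"
    and n: "\<And>i. \<tau> i \<omega> \<le> ennreal T \<longleftrightarrow> i < n"
  shows "claims T g \<omega> = (\<Sum>i<n. g (Z i \<omega>))"
proof -
  have Z0: "0 \<le> Z i \<omega>" for i using r by (simp add: regular_path_def)
  have fin: "\<tau> i \<omega> < \<infinity>" if "i < n" for i using that n[of i] by (simp add: order_le_less_trans)
  have [measurable]: "(\<lambda>p. g (snd p)) \<in> borel_measurable (Rplus \<Otimes>\<^sub>M Rplus)"
    using measurable_compose[OF measurable_snd g[unfolded measurable_Theta]] .
  note [measurable] = borel_measurable_fst_Rplus borel_measurable_snd_Rplus
  define h :: "real \<times> real \<Rightarrow> real"
    where "h p = (if 0 \<le> fst p \<and> fst p \<le> T \<and> 0 \<le> snd p then g (snd p) else 0)" for p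
  have h: "h \<in> borel_measurable (Rplus \<Otimes>\<^sub>M Rplus)" unfolding h_def by measurable
  have "claims T g \<omega> = integral\<^sup>L (\<nu> \<omega>) h"
    unfolding claims_def set_lebesgue_integral_def
    by (rule Bochner_Integration.integral_cong) (auto simp: h_def indicator_def)
  also have "\<dots> = (\<Sum>i<n. h (enn2real (\<tau> i \<omega>), Z i \<omega>))"
    by (rule integral_counting_random_measure[of Z \<omega>, OF Z0 h])
      (use n fin \<open>0 \<le> T\<close> in \<open>auto simp: h_def enn2real_le_iff\<close>)
  also have "\<dots> = (\<Sum>i<n. g (Z i \<omega>))"
    by (rule sum.cong) (use n fin Z0 \<open>0 \<le> T\<close> in \<open>auto simp: h_def enn2real_le_iff\<close>)
  finally show ?thesis .
qed

text \<open>On regular paths the integral is a countable sum of random variables. On the other paths nothing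
  is known of it, and completeness of the space makes up for that.\<close>

lemma claims_measurable:
  assumes g: "g \<in> borel_measurable \<Theta>" and T: "0 \<le> T"
  shows "claims T g \<in> borel_measurable Q"
proof -
  interpret complete_measure Q by (rule complete_space)
  have [measurable]: "(\<lambda>\<omega>. g (Z i \<omega>)) \<in> borel_measurable Q" for i
    using measurable_compose[OF Z_measurable_Rplus g[unfolded measurable_Theta]] .
  define Y where "Y \<omega> = (\<Sum>i. if \<tau> i \<omega> \<le> ennreal T then g (Z i \<omega>) else 0)" for \<omega>
  have Y: "Y \<in> borel_measurable Q" unfolding Y_def by measurable
  have "AE \<omega> in Q. Y \<omega> = claims T g \<omega>"
    using AE_regular
  proof eventually_elim
    case (elim \<omega>)
    obtain n where n: "\<And>i. \<tau> i \<omega> \<le> ennreal T \<longleftrightarrow> i < n"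
      using regular_path_upto[OF elim, of T] by blast
    have "Y \<omega> = (\<Sum>i<n. if \<tau> i \<omega> \<le> ennreal T then g (Z i \<omega>) else 0)"
      unfolding Y_def by (rule suminf_finite) (use n in auto)
    then show ?case using n by (simp add: claims_eq_sum[OF elim g T n])
  qed
  then have "AE \<omega> in Q. \<not> Y \<omega> \<noteq> claims T g \<omega>" by simp
  then have null: "{\<omega> \<in> space Q. Y \<omega> \<noteq> claims T g \<omega>} \<in> null_sets Q"
    by (simp add: AE_iff_null_sets)
  show ?thesis
  proof (rule measurableI)
    fix A :: "real set" assume A: "A \<in> sets borel"
    let ?E = "{\<omega> \<in> space Q. Y \<omega> \<noteq> claims T g \<omega>}"
    have "claims T g -` A \<inter> space Q = (Y -` A \<inter> space Q - ?E) \<union> (claims T g -` A \<inter> ?E)"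
      by auto
    also have "\<dots> \<in> sets Q"
      using measurable_sets[OF Y A] null complete2[OF _ null, of "claims T g -` A \<inter> ?E"] by blast
    finally show "claims T g -` A \<inter> space Q \<in> sets Q" .
  qed simp
qed

text \<open>The claims include a loss at time \<open>T\<close>, which \<open>L T\<close> omits; any later time would do instead
  of \<open>T + 1\<close>.\<close>

lemma claims_dominated:
  assumes g: "g \<in> borel_measurable \<Theta>" and T: "0 \<le> T" and bd: "AE z in \<Theta>. \<bar>g z\<bar> \<le> z"
  shows "AE \<omega> in Q. \<bar>claims T g \<omega>\<bar> \<le> enn2real (L (T + 1) \<omega>)"
  using AE_regular AE_marks[OF bd]
proof eventually_elim
  case (elim \<omega>)
  have Z0: "0 \<le> Z i \<omega>" for i using elim by (simp add: regular_path_def)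
  obtain n where n: "\<And>i. \<tau> i \<omega> \<le> ennreal T \<longleftrightarrow> i < n"
    using regular_path_upto[OF elim(1), of T] by blast
  obtain m where m: "\<And>i. \<tau> i \<omega> < ennreal (T + 1) \<longleftrightarrow> i < m"
    using regular_path_before[OF elim(1), of "T + 1"] by blast
  have "ennreal T < ennreal (T + 1)" using T by (intro ennreal_lessI) simp_all
  then have "i < m" if "i < n" for i using n m that order_le_less_trans by blast
  then have nm: "n \<le> m" by (meson leI less_irrefl)
  have fin: "\<tau> i \<omega> < \<infinity>" if "i < n" for i using that n[of i] by (simp add: order_le_less_trans)
  have "\<bar>claims T g \<omega>\<bar> \<le> (\<Sum>i<n. \<bar>g (Z i \<omega>)\<bar>)"
    unfolding claims_eq_sum[OF elim(1) g T n] by (rule sum_abs)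
  also have "\<dots> \<le> (\<Sum>i<n. Z i \<omega>)" by (rule sum_mono) (use elim(2) fin in auto)
  also have "\<dots> \<le> (\<Sum>i<m. Z i \<omega>)" by (rule sum_mono2) (use nm Z0 in auto)
  also have "\<dots> = enn2real (L (T + 1) \<omega>)"
    using losses_before_eq_sum[of \<tau> \<omega> "T + 1" m Z] m Z0 by (simp add: sum_nonneg)
  finally show ?case .
qed

lemma claims_tendsto:
  assumes g: "\<And>k. g k \<in> borel_measurable \<Theta>" and h: "h \<in> borel_measurable \<Theta>" and T: "0 \<le> T"
    and lim: "AE z in \<Theta>. (\<lambda>k. g k z) \<longlonglongrightarrow> h z"
  shows "AE \<omega> in Q. (\<lambda>k. claims T (g k) \<omega>) \<longlonglongrightarrow> claims T h \<omega>"
  using AE_regular AE_marks[OF lim]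
proof eventually_elim
  case (elim \<omega>)
  obtain n where n: "\<And>i. \<tau> i \<omega> \<le> ennreal T \<longleftrightarrow> i < n"
    using regular_path_upto[OF elim(1), of T] by blast
  have fin: "\<tau> i \<omega> < \<infinity>" if "i < n" for i using that n[of i] by (simp add: order_le_less_trans)
  show ?case unfolding claims_eq_sum[OF elim(1) g T n] claims_eq_sum[OF elim(1) h T n]
    by (rule tendsto_sum) (use elim(2) fin in auto)
qed

lemma claims_midpoint:
  assumes g: "g \<in> borel_measurable \<Theta>" and h: "h \<in> borel_measurable \<Theta>" and T: "0 \<le> T"
  shows "AE \<omega> in Q. claims T (\<lambda>z. (g z + h z) / 2) \<omega> = (claims T g \<omega> + claims T h \<omega>) / 2"
  using AE_regular
proof eventually_elim
  case (elim \<omega>)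
  obtain n where n: "\<And>i. \<tau> i \<omega> \<le> ennreal T \<longleftrightarrow> i < n"
    using regular_path_upto[OF elim(1), of T] by blast
  have gh: "(\<lambda>z. (g z + h z) / 2) \<in> borel_measurable \<Theta>" using g h by measurable
  show ?case unfolding claims_eq_sum[OF elim g T n] claims_eq_sum[OF elim h T n] claims_eq_sum[OF elim gh T n]
    by (simp add: sum.distrib sum_divide_distrib add_divide_distrib)
qed

section \<open>The optimal contract\<close>

lemma contract_measurable: "\<phi> \<in> contracts \<Theta> \<Longrightarrow> \<phi> \<in> borel_measurable \<Theta>"
  by (simp add: contracts_def)

lemma contract_bounds: "\<phi> \<in> contracts \<Theta> \<Longrightarrow> AE z in \<Theta>. 0 \<le> \<phi> z \<and> \<phi> z \<le> z"
  unfolding contracts_def by blast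

lemma contract_dominated:
  assumes "\<phi> \<in> contracts \<Theta>" shows "AE z in \<Theta>. \<bar>\<phi> z\<bar> \<le> z"
  using contract_bounds[OF assms] by eventually_elim simp

lemma contract_integrable:
  assumes "\<phi> \<in> contracts \<Theta>" shows "integrable \<Theta> \<phi>"
proof (rule Bochner_Integration.integrable_bound[OF integrable_Theta_id contract_measurable[OF assms]])
  show "AE z in \<Theta>. norm (\<phi> z) \<le> norm z"
    using contract_dominated[OF assms] by eventually_elim simp
qed

lemma contract_midpoint:
  assumes "\<phi> \<in> contracts \<Theta>" "\<psi> \<in> contracts \<Theta>"
  shows "(\<lambda>z. (\<phi> z + \<psi> z) / 2) \<in> contracts \<Theta>"
proof -
  have "AE z in \<Theta>. 0 \<le> (\<phi> z + \<psi> z) / 2 \<and> (\<phi> z + \<psi> z) / 2 \<le> z"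
    using contract_bounds[OF assms(1)] contract_bounds[OF assms(2)] by eventually_elim auto
  moreover have "(\<lambda>z. (\<phi> z + \<psi> z) / 2) \<in> borel_measurable \<Theta>"
    using assms[THEN contract_measurable] by measurable
  ultimately show ?thesis by (simp add: contracts_def)
qed

lemma contract_limit:
  assumes \<phi>: "\<And>n::nat. \<phi> n \<in> contracts \<Theta>" and g: "g \<in> borel_measurable \<Theta>"
    and lim: "AE z in \<Theta>. (\<lambda>n. \<phi> n z) \<longlonglongrightarrow> g z"
  shows "g \<in> contracts \<Theta>"
proof -
  have "AE z in \<Theta>. \<forall>n. 0 \<le> \<phi> n z \<and> \<phi> n z \<le> z"
    using \<phi> by (simp add: AE_all_countable contracts_def)
  with lim have "AE z in \<Theta>. 0 \<le> g z \<and> g z \<le> z"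
    by eventually_elim (blast intro: LIMSEQ_le_const LIMSEQ_le_const2)
  then show ?thesis using g by (simp add: contracts_def)
qed

text \<open>All contracts have wealths below a common square integrable bound \<open>W\<close>. The wealth depends on the
  contract through a sum over the marks and through an integral over \<open>\<Theta>\<close>; both are affine in
  the contract and continuous under dominated convergence, and the mean-variance functional turns
  this into midpoint concavity and continuity of the criterion.\<close>

theorem optimal_contract_exists:
  fixes R0 \<rho> c \<gamma> T :: real
  assumes \<gamma>: "0 \<le> \<gamma>" and T: "0 \<le> T"
  shows "\<exists>\<phi>\<in>contracts \<Theta>. \<forall>\<psi>\<in>contracts \<Theta>.
    criterion Q \<Theta> \<nu> R0 \<rho> c \<gamma> T \<psi> \<le> criterion Q \<Theta> \<nu> R0 \<rho> c \<gamma> T \<phi>"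
proof -
  define J where "J \<phi> = criterion Q \<Theta> \<nu> R0 \<rho> c \<gamma> T \<phi>" for \<phi>
  define R where "R \<phi> = wealth \<Theta> \<nu> R0 \<rho> c \<phi> T" for \<phi>
  define G where "G \<phi> z = \<phi> z - z" for \<phi> :: "real \<Rightarrow> real" and z
  define b where "b = \<bar>R0\<bar> + \<bar>\<rho> * mean_loss \<Theta> * T\<bar> + \<bar>c * T\<bar> * mean_loss \<Theta>"
  define W where "W \<omega> = enn2real (L (T + 1) \<omega>) + b" for \<omega>
  have J: "J \<phi> = mean_variance Q \<gamma> (R \<phi>)" for \<phi> by (simp add: J_def R_def criterion_def)
  have R: "R \<phi> \<omega> = R0 + claims T (G \<phi>) \<omega> + \<rho> * mean_loss \<Theta> * T - c * T * (\<integral>z. \<phi> z \<partial>\<Theta>)" for \<phi> \<omega>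
    by (simp add: R_def wealth_def claims_def G_def)
  have G[measurable]: "G \<phi> \<in> borel_measurable \<Theta>" if "\<phi> \<in> contracts \<Theta>" for \<phi>
    using contract_measurable[OF that] unfolding G_def by measurable
  have GD: "AE z in \<Theta>. \<bar>G \<phi> z\<bar> \<le> z" if "\<phi> \<in> contracts \<Theta>" for \<phi>
    using contract_bounds[OF that] by eventually_elim (simp add: G_def)
  have R_meas: "R \<phi> \<in> borel_measurable Q" if "\<phi> \<in> contracts \<Theta>" for \<phi>
    unfolding R[abs_def] using claims_measurable[OF G[OF that] T] by measurable
  have R_dom: "AE \<omega> in Q. \<bar>R \<phi> \<omega>\<bar> \<le> W \<omega>" if \<phi>: "\<phi> \<in> contracts \<Theta>" for \<phi>
  proof -
    have "\<bar>\<integral>z. \<phi> z \<partial>\<Theta>\<bar> \<le> (\<integral>z. \<bar>\<phi> z\<bar> \<partial>\<Theta>)" by (rule integral_abs_bound)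
    also have "\<dots> \<le> mean_loss \<Theta>" unfolding mean_loss_def
      by (rule integral_mono_AE[OF integrable_abs[OF contract_integrable[OF \<phi>]]
          integrable_Theta_id contract_dominated[OF \<phi>]])
    finally have premium: "\<bar>c * T * (\<integral>z. \<phi> z \<partial>\<Theta>)\<bar> \<le> \<bar>c * T\<bar> * mean_loss \<Theta>"
      unfolding abs_mult[of "c * T"] by (rule mult_left_mono) simp
    show ?thesis using claims_dominated[OF G[OF \<phi>] T GD[OF \<phi>]]
    proof eventually_elim
      case (elim \<omega>)
      then show ?case using premium unfolding R W_def b_def by linarith
    qed
  qed
  have Wm[measurable]: "W \<in> borel_measurable Q" unfolding W_def by measurable
  have "integrable Q (\<lambda>\<omega>. (enn2real (L (T + 1) \<omega>))\<^sup>2)"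
  proof (rule integrableI_nonneg)
    have "(\<integral>\<^sup>+\<omega>. ennreal ((enn2real (L (T + 1) \<omega>))\<^sup>2) \<partial>Q) = (\<integral>\<^sup>+\<omega>. (L (T + 1) \<omega>)\<^sup>2 \<partial>Q)"
      by (rule nn_integral_cong_AE)
        (use AE_regular in \<open>eventually_elim, simp add: ennreal_power[symmetric] losses_before_finite[simplified]\<close>)
    also have "\<dots> < \<infinity>" by (rule losses_second_moment) (use T in simp)
    finally show "(\<integral>\<^sup>+\<omega>. ennreal ((enn2real (L (T + 1) \<omega>))\<^sup>2) \<partial>Q) < \<infinity>" .
  qed simp_all
  then have W2: "integrable Q (\<lambda>\<omega>. (W \<omega>)\<^sup>2)"
    using square_integrable_imp_integrable[of "\<lambda>\<omega>. enn2real (L (T + 1) \<omega>)"]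
    by (simp add: W_def power2_sum)
  have R2: "integrable Q (\<lambda>\<omega>. (R \<phi> \<omega>)\<^sup>2)" if "\<phi> \<in> contracts \<Theta>" for \<phi>
    by (rule integrable_of_square_dominated[OF R_meas[OF that] W2 R_dom[OF that]])
  have R1: "integrable Q (R \<phi>)" if "\<phi> \<in> contracts \<Theta>" for \<phi>
    by (rule square_integrable_imp_integrable[OF R_meas[OF that] R2[OF that]])
  have W1: "integrable Q W"
    by (rule square_integrable_imp_integrable[OF Wm W2])
  have "\<exists>\<phi>\<in>contracts \<Theta>. \<forall>\<psi>\<in>contracts \<Theta>. J \<psi> \<le> J \<phi>"
  proof (rule midpoint_concave_attains_max[where w="\<lambda>z. z" and M=\<Theta>])
    show "finite_measure \<Theta>" by (rule finite_Theta)
    have "(\<lambda>z. z) \<in> contracts \<Theta>" by (auto simp: contracts_def space_Theta)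
    then show "contracts \<Theta> \<noteq> {}" by blast
    show "bdd_above (J ` contracts \<Theta>)"
    proof (rule bdd_aboveI2)
      fix \<phi> assume \<phi>: "\<phi> \<in> contracts \<Theta>"
      have "J \<phi> \<le> expectation (R \<phi>)"
        unfolding J mean_variance_def using \<gamma> variance_positive[of "R \<phi>"] by simp
      also have "\<dots> \<le> expectation W"
        by (rule integral_mono_AE[OF R1[OF \<phi>] W1])
          (use R_dom[OF \<phi>] in \<open>eventually_elim, linarith\<close>)
      finally show "J \<phi> \<le> expectation W" .
    qed
  next
    fix \<phi> \<psi> assume \<phi>: "\<phi> \<in> contracts \<Theta>" and \<psi>: "\<psi> \<in> contracts \<Theta>"
    let ?m = "\<lambda>z. (\<phi> z + \<psi> z) / 2"
    have m: "?m \<in> contracts \<Theta>" by (rule contract_midpoint[OF \<phi> \<psi>])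
    have Gm: "G ?m = (\<lambda>z. (G \<phi> z + G \<psi> z) / 2)" by (auto simp: G_def field_simps)
    have "(\<integral>z. ?m z \<partial>\<Theta>) = ((\<integral>z. \<phi> z \<partial>\<Theta>) + (\<integral>z. \<psi> z \<partial>\<Theta>)) / 2"
      using contract_integrable[OF \<phi>] contract_integrable[OF \<psi>] by simp
    with claims_midpoint[OF G[OF \<phi>] G[OF \<psi>] T]
    have Rm: "AE \<omega> in Q. R ?m \<omega> = (R \<phi> \<omega> + R \<psi> \<omega>) / 2"
      by (auto elim!: eventually_mono simp: R Gm field_simps)
    have [measurable]: "R \<phi> \<in> borel_measurable Q" "R \<psi> \<in> borel_measurable Q" "R ?m \<in> borel_measurable Q"
      using R_meas \<phi> \<psi> m by blast+
    have "mean_variance Q \<gamma> (R ?m) = mean_variance Q \<gamma> (\<lambda>\<omega>. (R \<phi> \<omega> + R \<psi> \<omega>) / 2)"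
      by (rule mean_variance_cong_AE) (use Rm in measurable)
    then show "J \<phi> + J \<psi> \<le> 2 * J ?m"
      unfolding J using mean_variance_midpoint[OF _ _ R2[OF \<phi>] R2[OF \<psi>] \<gamma>] by simp
  next
    fix \<phi> g assume \<phi>: "\<And>n::nat. \<phi> n \<in> contracts \<Theta>" and g: "g \<in> contracts \<Theta>"
      and lim: "AE z in \<Theta>. (\<lambda>n. \<phi> n z) \<longlonglongrightarrow> g z"
    have "AE z in \<Theta>. (\<lambda>n. G (\<phi> n) z) \<longlonglongrightarrow> G g z"
      using lim by eventually_elim (auto simp: G_def intro: tendsto_intros)
    then have "AE \<omega> in Q. (\<lambda>n. claims T (G (\<phi> n)) \<omega>) \<longlonglongrightarrow> claims T (G g) \<omega>"
      using G \<phi> g T by (intro claims_tendsto) auto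
    moreover have "(\<lambda>n. \<integral>z. \<phi> n z \<partial>\<Theta>) \<longlonglongrightarrow> (\<integral>z. g z \<partial>\<Theta>)"
    proof (rule integral_dominated_convergence[where w="\<lambda>z. z"])
      show "AE z in \<Theta>. norm (\<phi> n z) \<le> z" for n
        using contract_dominated[OF \<phi>] by simp
    qed (rule contract_measurable[OF g] contract_measurable[OF \<phi>] integrable_Theta_id lim)+
    ultimately have "AE \<omega> in Q. (\<lambda>n. R (\<phi> n) \<omega>) \<longlonglongrightarrow> R g \<omega>"
      unfolding R by (elim eventually_mono) (intro tendsto_intros; assumption)
    then show "(\<lambda>n. J (\<phi> n)) \<longlonglongrightarrow> J g"
      unfolding J by (intro mean_variance_tendsto[OF R_meas[OF \<phi>] R_meas[OF g] Wm W2 R_dom[OF \<phi>]])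
  qed (fact contract_measurable contract_dominated contract_midpoint contract_limit
      integrable_Theta_square)+
  then show ?thesis by (simp add: J_def)
qed

end

theorem proposition2:
  fixes Q :: "'a measure" and F :: "real \<Rightarrow> 'a measure" and \<Theta> :: "real measure"
    and \<tau> :: "nat \<Rightarrow> 'a \<Rightarrow> ennreal" and Z :: "nat \<Rightarrow> 'a \<Rightarrow> real" and lam :: "real \<Rightarrow> 'a \<Rightarrow> real"
    and \<beta> \<Lambda> l0 l R0 \<rho> c \<gamma> T :: real
  assumes "usual_filtered_prob_space Q F"
    and "sets \<Theta> = sets Rplus"
    and "(\<integral>\<^sup>+z. ennreal (1 + z + z\<^sup>2) \<partial>\<Theta>) < \<infinity>"
    and "0 \<le> \<Lambda>" and "\<Lambda> * mean_loss \<Theta> < \<beta>"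
    and "0 \<le> l" and "l < l0"
    and "marked_hawkes_process Q F \<Theta> (\<lambda>z. \<Lambda> * z) \<beta> l0 l \<tau> Z lam"
    and "0 < \<gamma>" and "0 < T"
  shows "\<exists>\<phi>\<in>contracts \<Theta>.
    ereal (criterion Q \<Theta> (counting_random_measure \<tau> Z) R0 \<rho> c \<gamma> T \<phi>) =
    (SUP \<psi>\<in>contracts \<Theta>. ereal (criterion Q \<Theta> (counting_random_measure \<tau> Z) R0 \<rho> c \<gamma> T \<psi>))"
proof -
  have "space \<Theta> = {0..}"
    using sets_eq_imp_space_eq[OF assms(2)] by (simp add: space_restrict_space)
  then have "0 \<le> mean_loss \<Theta>"
    unfolding mean_loss_def by (intro integral_nonneg_AE AE_I2) simp
  then have "0 \<le> \<beta>" using assms(4,5) mult_nonneg_nonneg[of \<Lambda> "mean_loss \<Theta>"] by linarith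
  then interpret hawkes_losses Q F \<Theta> \<tau> Z lam \<beta> \<Lambda> l0 l
    using assms by (intro hawkes_losses.intro hawkes_losses_axioms.intro) auto
  obtain \<phi> where \<phi>: "\<phi> \<in> contracts \<Theta>" and opt: "\<And>\<psi>. \<psi> \<in> contracts \<Theta> \<Longrightarrow>
      criterion Q \<Theta> \<nu> R0 \<rho> c \<gamma> T \<psi> \<le> criterion Q \<Theta> \<nu> R0 \<rho> c \<gamma> T \<phi>"
    using optimal_contract_exists[of \<gamma> T R0 \<rho> c] assms(9,10) by auto
  have "ereal (criterion Q \<Theta> \<nu> R0 \<rho> c \<gamma> T \<phi>) = (SUP \<psi>\<in>contracts \<Theta>. ereal (criterion Q \<Theta> \<nu> R0 \<rho> c \<gamma> T \<psi>))"
    by (intro antisym SUP_upper SUP_least) (use \<phi> opt in auto)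
  then show ?thesis using \<phi> by blast
qed

end
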